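(* Let $K \in \mathbb{N}$ and let $V = V(x)$ be a smooth $2\pi$-periodic real-valued function of one variable with zero average. Assume that for all $k = 1,\ldots,K$ there exist $a_k < b_k$ in $[0,2\pi]$ such that $[a_j,b_j] \cap [a_k,b_k] = \emptyset$ for all $j \neq k$ in $\{1,\ldots,K\}$, and such that $V''(x) = 0$ for all $x \in [a_k,b_k]$, $k = 1,\ldots,K$ (so that $V'$ is constant on each $[a_k,b_k]$). Then for all $k = 1,\ldots,K$ there exist points $(x_k,y_k) \in (a_k,b_k) \times \mathbb{T}$ and zero average functions $\Omega_k, \Psi_k : \mathbb{T}^2 \to \mathbb{R}$, with compact support in $(a_k,b_k) \times \mathbb{T}$ and radial symmetry around $(x_k,y_k)$, such that, with $v_k = V'(x_k)$, the couple $$ \omega(t,x,y) = V''(x) + \sum_{k=1}^K \Omega_k(x, y - v_k t) $$ and $$ \psi(t,x,y) = V(x) + \sum_{k=1}^K \Psi_k(x, y - v_k t) $$ is a quasi-periodic (in time) solution of the two-dimensional Euler equation in vorticity form on $\mathbb{T}^2$, $$ \partial_t \omega + \{\psi, \omega\} = 0, \qquad \Delta \psi = \omega . $$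
   Context: $\mathbb{T} = \mathbb{R}/2\pi\mathbb{Z}$, and $\mathbb{T}^2 = (\mathbb{R}/2\pi\mathbb{Z})^2$ is the two-dimensional torus with coordinates $(x,y)$. For an interval $(a,b) \subset [0,2\pi]$, the strip $(a,b)\times\mathbb{T}$ is viewed as a subset of $\mathbb{T}^2$. The Poisson bracket of functions on $\mathbb{T}^2$ is $$\{f,g\} = (\partial_x f)(\partial_y g) - (\partial_y f)(\partial_x g),$$ and $\Delta = \partial_{xx} + \partial_{yy}$. The unknowns are the vorticity $\omega(t,x,y) \in \mathbb{R}$ and the stream function $\psi(t,x,y) \in \mathbb{R}$, where $t$ is time and $(x,y) \in \mathbb{T}^2$. The stream function is $\psi = \Delta^{-1}\omega$, where $\Delta^{-1}$ is the inverse of the Laplace operator on functions with average $0$ on $\mathbb{T}^2$. Solutions are understood in the classical sense: the functions are regular enough that the equations hold pointwise. "Zero average" means that the integral vanishes (over $\mathbb{T}$ for $V$, over $\mathbb{T}^2$ for $\Omega_k$ and $\Psi_k$). "Radial symmetry around $(x_k,y_k)$" means that the function depends on $(x,y)$ only through the (flat torus) distance from $(x,y)$ to $(x_k,y_k)$. "Quasi-periodic in time" means that the time dependence is through finitely many angles evolving linearly, here with frequencies $v_1,\ldots,v_K$: there are functions $W, Z$ on $\mathbb{T}^K \times \mathbb{T}^2$ such that $\omega(t,x,y) = W(v_1 t,\ldots,v_K t, x, y)$ and $\psi(t,x,y) = Z(v_1 t,\ldots,v_K t, x, y)$. No rational independence of the frequencies is required. *)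

theory Defs
  imports "HOL-Analysis.Analysis" "HOL-Library.Periodic_Fun"
begin

text \<open>
  Functions on the circle (the reals modulo \<open>2\<pi>\<close>) and on the two-dimensional torus are represented
  by their \<open>2\<pi>\<close>-periodic lifts to the reals and to the plane.
\<close>

section \<open>Functions of one variable\<close>

definition smooth :: "(real \<Rightarrow> real) \<Rightarrow> bool" where
  "smooth f \<longleftrightarrow> (\<forall>n x. ((deriv ^^ n) f) differentiable (at x))"

definition circle_zero_average :: "(real \<Rightarrow> real) \<Rightarrow> bool" where
  "circle_zero_average f \<longleftrightarrow> (f has_integral 0) {0..2*pi}"


section \<open>Functions on the two-dimensional torus\<close>

definition torus_fun :: "(real \<Rightarrow> real \<Rightarrow> 'a) \<Rightarrow> bool" where
  "torus_fun f \<longleftrightarrow> periodic_fun_simple f (2*pi) \<and> (\<forall>x. periodic_fun_simple (f x) (2*pi))"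

definition torus_zero_average :: "(real \<Rightarrow> real \<Rightarrow> real) \<Rightarrow> bool" where
  "torus_zero_average f \<longleftrightarrow> ((\<lambda>(x, y). f x y) has_integral 0) (cbox (0, 0) (2*pi, 2*pi))"

definition circle_dist :: "real \<Rightarrow> real \<Rightarrow> real" where
  "circle_dist s s' = (INF n::int. \<bar>s - s' - 2 * pi * of_int n\<bar>)"

text \<open>The flat distance on the torus.\<close>

definition torus_dist :: "real \<times> real \<Rightarrow> real \<times> real \<Rightarrow> real" where
  "torus_dist p q = sqrt ((circle_dist (fst p) (fst q))\<^sup>2 + (circle_dist (snd p) (snd q))\<^sup>2)"

definition radially_symmetric_around :: "(real \<Rightarrow> real \<Rightarrow> real) \<Rightarrow> real \<times> real \<Rightarrow> bool" where
  "radially_symmetric_around f c \<longleftrightarrow> (\<exists>g::real \<Rightarrow> real. \<forall>x y. f x y = g (torus_dist (x, y) c))"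

text \<open>
  The preimage in the plane of the strip with \<open>x\<close> in \<open>(a, b)\<close> in the torus, and the preimage of the
  support of a function on the torus.  The latter is closed, and closed subsets of the torus are
  compact: hence a function on the torus has compact support in an open set iff its support is
  contained in that set.
\<close>

definition torus_strip :: "real \<Rightarrow> real \<Rightarrow> (real \<times> real) set" where
  "torus_strip a b = {(x, y). \<exists>n::int. x - 2 * pi * of_int n \<in> {a<..<b}}"

definition torus_support :: "(real \<Rightarrow> real \<Rightarrow> real) \<Rightarrow> (real \<times> real) set" where
  "torus_support f = closure {(x, y). f x y \<noteq> 0}"

definition dx :: "(real \<Rightarrow> real \<Rightarrow> real) \<Rightarrow> real \<Rightarrow> real \<Rightarrow> real" where
  "dx f = (\<lambda>x y. deriv (\<lambda>s. f s y) x)"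

definition dy :: "(real \<Rightarrow> real \<Rightarrow> real) \<Rightarrow> real \<Rightarrow> real \<Rightarrow> real" where
  "dy f = (\<lambda>x y. deriv (\<lambda>s. f x s) y)"

definition poisson_bracket ::
    "(real \<Rightarrow> real \<Rightarrow> real) \<Rightarrow> (real \<Rightarrow> real \<Rightarrow> real) \<Rightarrow> real \<Rightarrow> real \<Rightarrow> real" where
  "poisson_bracket f g = (\<lambda>x y. dx f x y * dy g x y - dy f x y * dx g x y)"

definition laplacian :: "(real \<Rightarrow> real \<Rightarrow> real) \<Rightarrow> real \<Rightarrow> real \<Rightarrow> real" where
  "laplacian f = (\<lambda>x y. dx (dx f) x y + dy (dy f) x y)"


section \<open>Classical solutions of the Euler equation\<close>

definition dt :: "(real \<Rightarrow> real \<Rightarrow> real \<Rightarrow> real) \<Rightarrow> real \<Rightarrow> real \<Rightarrow> real \<Rightarrow> real" where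
  "dt f = (\<lambda>t x y. deriv (\<lambda>s. f s x y) t)"

text \<open>
  Functions of \<open>(t, x, y)\<close> of class \<open>C\<^sup>n\<close>: all partial derivatives of order at most \<open>n\<close> exist
  and are jointly continuous.
\<close>

primrec C_k :: "nat \<Rightarrow> (real \<Rightarrow> real \<Rightarrow> real \<Rightarrow> real) \<Rightarrow> bool" where
  "C_k 0 f \<longleftrightarrow> continuous_on UNIV (\<lambda>(t, x, y). f t x y)"
| "C_k (Suc n) f \<longleftrightarrow>
     continuous_on UNIV (\<lambda>(t, x, y). f t x y) \<and>
     (\<forall>t x y. (\<lambda>s. f s x y) differentiable (at t) \<and>
              (\<lambda>s. f t s y) differentiable (at x) \<and>
              (\<lambda>s. f t x s) differentiable (at y)) \<and>
     C_k n (dt f) \<and> C_k n (\<lambda>t. dx (f t)) \<and> C_k n (\<lambda>t. dy (f t))"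

text \<open>
  The two zero average conditions together with the equation \<open>\<Delta>\<psi> = \<omega>\<close> express
  \<open>\<psi> = \<Delta>\<^sup>-\<^sup>1\<omega>\<close>, where the inverse is that of the Laplace operator on functions of zero average.
\<close>

definition classical_euler_solution ::
    "(real \<Rightarrow> real \<Rightarrow> real \<Rightarrow> real) \<Rightarrow> (real \<Rightarrow> real \<Rightarrow> real \<Rightarrow> real) \<Rightarrow> bool" where
  "classical_euler_solution \<omega> \<psi> \<longleftrightarrow>
     C_k 1 \<omega> \<and> C_k 2 \<psi> \<and>
     (\<forall>t. torus_fun (\<omega> t) \<and> torus_fun (\<psi> t) \<and>
          torus_zero_average (\<omega> t) \<and> torus_zero_average (\<psi> t)) \<and>
     (\<forall>t x y. dt \<omega> t x y + poisson_bracket (\<psi> t) (\<omega> t) x y = 0) \<and>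
     (\<forall>t x y. laplacian (\<psi> t) x y = \<omega> t x y)"


section \<open>Quasi-periodicity in time\<close>

text \<open>
  The angles \<open>(\<theta>\<^sub>1, \<dots>, \<theta>\<^sub>K)\<close> range over the functions from \<open>{1..K}\<close> to the reals, extended by
  \<open>undefined\<close> outside \<open>{1..K}\<close>; the profile \<open>W\<close> is \<open>2\<pi>\<close>-periodic in each of them and in
  \<open>x\<close> and \<open>y\<close>.  Continuity of \<open>W\<close> is part of the notion: without it, every function of \<open>t\<close> would
  be quasi-periodic as soon as two frequencies are rationally independent.
\<close>

definition quasi_periodic ::
    "nat \<Rightarrow> (nat \<Rightarrow> real) \<Rightarrow> (real \<Rightarrow> real \<Rightarrow> real \<Rightarrow> real) \<Rightarrow> bool" where
  "quasi_periodic K v f \<longleftrightarrow>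
     (\<exists>W :: (nat \<Rightarrow> real) \<Rightarrow> real \<Rightarrow> real \<Rightarrow> real.
        (\<forall>\<theta>\<in>{1..K} \<rightarrow>\<^sub>E UNIV. \<forall>k\<in>{1..K}. W (\<theta>(k := \<theta> k + 2*pi)) = W \<theta>) \<and>
        (\<forall>\<theta>\<in>{1..K} \<rightarrow>\<^sub>E UNIV. torus_fun (W \<theta>)) \<and>
        continuous_on (({1..K} \<rightarrow>\<^sub>E UNIV) \<times> UNIV \<times> UNIV) (\<lambda>(\<theta>, x, y). W \<theta> x y) \<and>
        (\<forall>t x y. f t x y = W (\<lambda>k\<in>{1..K}. v k * t) x y))"

end

theory Submission
  imports Defs
begin

text \<open>
  Inside the \<open>k\<close>-th strip the shear flow with stream function \<open>V\<close> has the constant velocity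
  \<open>v\<^sub>k = V'\<close> and no vorticity, so a perturbation that lives there sees nothing but a uniform drift
  in \<open>y\<close>: if \<open>\<Psi>\<close> with \<open>\<Omega> = \<Delta>\<Psi>\<close> is a stationary solution whose stream function and vorticity are
  both supported in the strip, then \<open>V + \<Psi>(x, y - v\<^sub>k t)\<close> is a solution.  Perturbations in
  different strips do not interact, since in the Poisson bracket all products of terms with
  disjoint supports vanish.  This is \<open>euler_superposition\<close>.

  Radial functions provide such stationary solutions, because the gradients of two functions that
  are radial around the same point are parallel.  The stream function itself has to be compactly
  supported and of zero average, not only the vorticity.  Both averages come for free if one
  starts one level higher: for every compactly supported radial \<open>\<Phi>\<close>, the functions \<open>\<Psi> = \<Delta>\<Phi>\<close> and
  \<open>\<Omega> = \<Delta>\<Psi>\<close> are radial and supported in the support of \<open>\<Phi>\<close>, and the Laplacian of a periodic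
  function always has zero average (\<open>torus_zero_average_laplacian\<close>).

  The choice is \<open>\<Phi> = w\<^sup>6\<close>, where \<open>w = max 0 (R\<^sup>2 - r\<^sup>2)\<close> and \<open>r\<close> is the distance from the centre.
  The power \<open>w\<^sup>p\<close> is of class \<open>C\<^sup>p\<^sup>-\<^sup>1\<close>, and the Laplacian maps it to a combination of \<open>w\<^sup>p\<^sup>-\<^sup>2\<close> and
  \<open>w\<^sup>p\<^sup>-\<^sup>1\<close> (\<open>laplacian_cap_power\<close>).  Hence \<open>\<Psi>\<close> is a combination of \<open>w\<^sup>4\<close> and \<open>w\<^sup>5\<close>, and \<open>\<Omega>\<close> one of
  \<open>w\<^sup>2\<close>, \<open>w\<^sup>3\<close> and \<open>w\<^sup>4\<close>, which is of class \<open>C\<^sup>1\<close> and therefore regular enough for a classical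
  solution.
\<close>

section \<open>Calculus of functions of class $C^n$\<close>

lemma C_k_imp_continuous:
  "C_k n f \<Longrightarrow> continuous_on UNIV (\<lambda>(t, x, y). f t x y)"
  by (cases n) auto

lemma C_k_has_partials:
  assumes "C_k (Suc n) f"
  shows "((\<lambda>s. f s x y) has_field_derivative dt f t x y) (at t)"
    and "((\<lambda>s. f t s y) has_field_derivative dx (f t) x y) (at x)"
    and "((\<lambda>s. f t x s) has_field_derivative dy (f t) x y) (at y)"
  using assms by (simp_all add: dt_def dx_def dy_def DERIV_deriv_iff_real_differentiable)

lemma C_k_partials:
  assumes "C_k (Suc n) f"
  shows "C_k n (dt f)" "C_k n (\<lambda>t. dx (f t))" "C_k n (\<lambda>t. dy (f t))"
  using assms by simp_all

text \<open>
  For a family of functions that is closed under differentiation, this reduces membership in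
  \<open>C_k n\<close> to continuity and a list of derivatives, by induction on \<open>n\<close>.
\<close>

lemma C_k_SucI:
  assumes "continuous_on UNIV (\<lambda>(t, x, y). f t x y)"
    and ft: "\<And>t x y. ((\<lambda>s. f s x y) has_field_derivative ft t x y) (at t)"
    and fx: "\<And>t x y. ((\<lambda>s. f t s y) has_field_derivative fx t x y) (at x)"
    and fy: "\<And>t x y. ((\<lambda>s. f t x s) has_field_derivative fy t x y) (at y)"
    and "C_k n ft" "C_k n fx" "C_k n fy"
  shows "C_k (Suc n) f"
proof -
  have "dt f = ft" "(\<lambda>t. dx (f t)) = fx" "(\<lambda>t. dy (f t)) = fy"
    using DERIV_imp_deriv[OF ft] DERIV_imp_deriv[OF fx] DERIV_imp_deriv[OF fy]
    by (auto simp: dt_def dx_def dy_def fun_eq_iff)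
  then show ?thesis
    using assms unfolding C_k.simps real_differentiable_def by metis
qed

lemma C_k_zero: "C_k n (\<lambda>t x y. 0)"
proof (induction n)
  case (Suc n)
  then show ?case
    by (intro C_k_SucI[where ft = "\<lambda>t x y. 0" and fx = "\<lambda>t x y. 0" and fy = "\<lambda>t x y. 0"])
      (auto simp: case_prod_unfold)
qed simp

lemma C_k_add:
  assumes "C_k n f" "C_k n g"
  shows "C_k n (\<lambda>t x y. f t x y + g t x y)"
  using assms
proof (induction n arbitrary: f g)
  case 0
  then show ?case by (auto simp: case_prod_unfold intro!: continuous_intros)
next
  case (Suc n)
  show ?case
  proof (rule C_k_SucI)
    show "continuous_on UNIV (\<lambda>(t, x, y). f t x y + g t x y)"
      using Suc.prems[THEN C_k_imp_continuous]
      by (auto simp: case_prod_unfold intro!: continuous_intros)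
    show "C_k n (\<lambda>t x y. dt f t x y + dt g t x y)"
      "C_k n (\<lambda>t x y. dx (f t) x y + dx (g t) x y)"
      "C_k n (\<lambda>t x y. dy (f t) x y + dy (g t) x y)"
      using Suc.prems by (auto intro!: Suc.IH)
  qed (intro DERIV_add C_k_has_partials[OF Suc.prems(1)] C_k_has_partials[OF Suc.prems(2)])+
qed

lemma C_k_scale:
  assumes "C_k n f"
  shows "C_k n (\<lambda>t x y. c * f t x y)"
  using assms
proof (induction n arbitrary: f)
  case 0
  then show ?case by (auto simp: case_prod_unfold intro!: continuous_intros)
next
  case (Suc n)
  show ?case
  proof (rule C_k_SucI)
    show "continuous_on UNIV (\<lambda>(t, x, y). c * f t x y)"
      using Suc.prems[THEN C_k_imp_continuous]
      by (auto simp: case_prod_unfold intro!: continuous_intros)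
    show "C_k n (\<lambda>t x y. c * dt f t x y)"
      "C_k n (\<lambda>t x y. c * dx (f t) x y)"
      "C_k n (\<lambda>t x y. c * dy (f t) x y)"
      using Suc.prems by (auto intro!: Suc.IH)
  qed (intro DERIV_cmult C_k_has_partials[OF Suc.prems(1)])+
qed

lemma C_k_sum:
  assumes "finite I" "\<And>i. i \<in> I \<Longrightarrow> C_k n (f i)"
  shows "C_k n (\<lambda>t x y. \<Sum>i\<in>I. f i t x y)"
  using assms by (induction I) (simp_all add: C_k_zero C_k_add)

text \<open>
  The time derivative of \<open>f x (y - v * t)\<close> is again a travelling function, namely \<open>- v\<close> times that
  of \<open>dy f\<close>.
\<close>

lemma C_k_travelling:
  assumes "C_k n (\<lambda>t. f)"
  shows "C_k n (\<lambda>t x y. f x (y - v * t))"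
  using assms
proof (induction n arbitrary: f)
  case 0
  then have "continuous_on UNIV ((\<lambda>(t, x, y). f x y) \<circ> (\<lambda>(t, x, y). (t, x, y - v * t)))"
    by (intro continuous_on_compose continuous_on_subset[OF C_k_imp_continuous[OF 0]])
      (auto simp: case_prod_unfold intro!: continuous_intros)
  then show ?case by (simp add: case_prod_unfold o_def)
next
  case (Suc n)
  note partials = C_k_has_partials[OF Suc.prems]
  have "C_k n (\<lambda>t. dx f)" and "C_k n (\<lambda>t. dy f)"
    using Suc.prems by auto
  note IH = this[THEN Suc.IH]
  show ?case
  proof (rule C_k_SucI)
    have "continuous_on UNIV ((\<lambda>(t, x, y). f x y) \<circ> (\<lambda>(t, x, y). (t, x, y - v * t)))"
      by (intro continuous_on_compose continuous_on_subset[OF C_k_imp_continuous[OF Suc.prems]])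
        (auto simp: case_prod_unfold intro!: continuous_intros)
    then show "continuous_on UNIV (\<lambda>(t, x, y). f x (y - v * t))"
      by (simp add: case_prod_unfold o_def)
    show "((\<lambda>s. f x (y - v * s)) has_field_derivative (- v) * dy f x (y - v * t)) (at t)" for t x y
      by (rule DERIV_chain'[OF _ partials(3), THEN DERIV_cong])
        (auto intro!: derivative_eq_intros)
    show "((\<lambda>s. f s (y - v * t)) has_field_derivative dx f x (y - v * t)) (at x)" for t x y
      by (rule partials(2))
    show "((\<lambda>s. f x (s - v * t)) has_field_derivative dy f x (y - v * t)) (at y)" for t x y
      by (rule DERIV_chain'[OF _ partials(3), THEN DERIV_cong])
        (auto intro!: derivative_eq_intros)
    show "C_k n (\<lambda>t x y. (- v) * dy f x (y - v * t))"
      by (rule C_k_scale[OF IH(2)])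
  qed (fact IH)+
qed

lemma smooth_deriv:
  assumes "smooth f"
  shows "smooth (deriv f)"
  unfolding smooth_def
proof (intro allI)
  fix n x
  have "(deriv ^^ Suc n) f differentiable (at x)"
    using assms unfolding smooth_def by blast
  then show "(deriv ^^ n) (deriv f) differentiable (at x)"
    by (simp add: funpow_swap1)
qed

lemma smooth_has_deriv: "smooth f \<Longrightarrow> (f has_field_derivative deriv f x) (at x)"
  unfolding smooth_def DERIV_deriv_iff_real_differentiable by (drule spec[of _ 0]) simp

lemma smooth_continuous: "smooth f \<Longrightarrow> continuous_on A f"
  by (meson DERIV_isCont continuous_at_imp_continuous_on smooth_has_deriv)

lemma C_k_shear: "smooth f \<Longrightarrow> C_k n (\<lambda>t x y. f x)"
proof (induction n arbitrary: f)
  case 0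
  then show ?case
    by (auto simp: case_prod_unfold
        intro!: continuous_intros continuous_on_compose2[OF smooth_continuous[of f UNIV]])
next
  case (Suc n)
  show ?case
  proof (rule C_k_SucI[where ft = "\<lambda>t x y. 0" and fx = "\<lambda>t x y. deriv f x" and fy = "\<lambda>t x y. 0"])
    show "continuous_on UNIV (\<lambda>(t::real, x, y::real). f x)"
      using Suc.prems
      by (auto simp: case_prod_unfold
          intro!: continuous_intros continuous_on_compose2[OF smooth_continuous[of f UNIV]])
    show "C_k n (\<lambda>t x y. deriv f x)"
      using Suc by (simp add: smooth_deriv)
    show "((\<lambda>s. f s) has_field_derivative deriv f x) (at x)" for x
      by (rule smooth_has_deriv[OF Suc.prems])
  qed (rule DERIV_const C_k_zero)+
qed

lemma dx_linear:
  assumes "C_k (Suc n) (\<lambda>t. f)" "C_k (Suc n) (\<lambda>t. g)"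
  shows "dx (\<lambda>x y. r * f x y + s * g x y) = (\<lambda>x y. r * dx f x y + s * dx g x y)"
proof (intro ext)
  fix x y
  have "((\<lambda>u. r * f u y + s * g u y) has_field_derivative r * dx f x y + s * dx g x y) (at x)"
    by (intro DERIV_add DERIV_cmult C_k_has_partials(2)[OF assms(1)] C_k_has_partials(2)[OF assms(2)])
  then show "dx (\<lambda>x y. r * f x y + s * g x y) x y = r * dx f x y + s * dx g x y"
    unfolding dx_def[of "\<lambda>x y. r * f x y + s * g x y"] by (rule DERIV_imp_deriv)
qed

lemma dy_linear:
  assumes "C_k (Suc n) (\<lambda>t. f)" "C_k (Suc n) (\<lambda>t. g)"
  shows "dy (\<lambda>x y. r * f x y + s * g x y) = (\<lambda>x y. r * dy f x y + s * dy g x y)"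
proof (intro ext)
  fix x y
  have "((\<lambda>u. r * f x u + s * g x u) has_field_derivative r * dy f x y + s * dy g x y) (at y)"
    by (intro DERIV_add DERIV_cmult C_k_has_partials(3)[OF assms(1)] C_k_has_partials(3)[OF assms(2)])
  then show "dy (\<lambda>x y. r * f x y + s * g x y) x y = r * dy f x y + s * dy g x y"
    unfolding dy_def[of "\<lambda>x y. r * f x y + s * g x y"] by (rule DERIV_imp_deriv)
qed

lemma laplacian_linear:
  assumes "C_k 2 (\<lambda>t. f)" "C_k 2 (\<lambda>t. g)"
  shows "laplacian (\<lambda>x y. r * f x y + s * g x y) = (\<lambda>x y. r * laplacian f x y + s * laplacian g x y)"
proof -
  have f: "C_k (Suc (Suc 0)) (\<lambda>t. f)" and g: "C_k (Suc (Suc 0)) (\<lambda>t. g)"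
    using assms by (simp_all only: numeral_2_eq_2)
  have f': "C_k (Suc 0) (\<lambda>t. dx f)" "C_k (Suc 0) (\<lambda>t. dy f)"
    and g': "C_k (Suc 0) (\<lambda>t. dx g)" "C_k (Suc 0) (\<lambda>t. dy g)"
    using f g by (auto dest: C_k_partials)
  note fg = dx_linear[OF f g] dy_linear[OF f g] dx_linear[OF f'(1) g'(1)] dy_linear[OF f'(2) g'(2)]
  show ?thesis
    by (simp add: laplacian_def fg algebra_simps)
qed

section \<open>Laplacians of periodic functions have zero average\<close>

lemma torus_fun_iff:
  "torus_fun f \<longleftrightarrow> (\<forall>x y. f (x + 2*pi) y = f x y \<and> f x (y + 2*pi) = f x y)"
  unfolding torus_fun_def periodic_fun_simple_def by (auto simp: fun_eq_iff)

lemma deriv_translate: "deriv (\<lambda>s. f (s + c)) x = deriv f (x + c)" for f :: "real \<Rightarrow> real"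
  unfolding deriv_def by (subst DERIV_shift) simp

lemma deriv_periodic:
  fixes f :: "real \<Rightarrow> real"
  assumes "\<And>x. f (x + p) = f x"
  shows "deriv f (x + p) = deriv f x"
  using deriv_translate[of f p x] by (simp add: assms)

lemma torus_fun_dx:
  assumes "torus_fun f"
  shows "torus_fun (dx f)"
  using assms deriv_periodic[of "\<lambda>s. f s _" "2*pi"]
  by (simp add: torus_fun_iff dx_def)

lemma torus_fun_dy:
  assumes "torus_fun f"
  shows "torus_fun (dy f)"
proof -
  have "f (x + 2*pi) = f x" for x
    using assms by (simp add: torus_fun_iff fun_eq_iff)
  then show ?thesis
    using assms deriv_periodic[of "f _" "2*pi"]
    by (simp add: torus_fun_iff dy_def)
qed

lemma torus_zero_average_if_slices:
  fixes F :: "real \<Rightarrow> real \<Rightarrow> real"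
  assumes cont: "continuous_on UNIV (\<lambda>(x, y). F x y)"
    and inner: "\<And>y. ((\<lambda>x. F x y) has_integral 0) {0..2*pi}"
  shows "torus_zero_average F"
proof -
  have cont': "continuous_on S (\<lambda>(x, y). F x y)" for S
    using cont continuous_on_subset by blast
  have "integral (cbox (0, 0) (2*pi, 2*pi)) (\<lambda>(x, y). F x y) =
        integral (cbox 0 (2*pi)) (\<lambda>x. integral (cbox 0 (2*pi)) (F x))"
    using integral_prod_continuous[OF cont'] by simp
  also have "\<dots> = integral (cbox 0 (2*pi)) (\<lambda>y. integral (cbox 0 (2*pi)) (\<lambda>x. F x y))"
    by (rule integral_swap_continuous[OF cont'])
  also have "\<dots> = 0"
    unfolding cbox_interval inner[THEN integral_unique] by simp
  finally show ?thesis
    unfolding torus_zero_average_def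
    using integrable_continuous[OF cont'] by (metis has_integral_integral)
qed

lemma torus_zero_average_swap:
  assumes "continuous_on UNIV (\<lambda>(x, y). F x y)" "torus_zero_average (\<lambda>x y. F y x)"
  shows "torus_zero_average F"
proof -
  have cont': "continuous_on S (\<lambda>(x, y). F x y)" for S
    using assms(1) continuous_on_subset by blast
  have "integral (cbox (0, 0) (2*pi, 2*pi)) (\<lambda>(x, y). F x y) =
        integral (cbox (0, 0) (2*pi, 2*pi)) (\<lambda>(x, y). F y x)"
    by (rule integral_swap_2dim[OF cont'])
  also have "\<dots> = 0"
    using assms(2) unfolding torus_zero_average_def by (rule integral_unique)
  finally show ?thesis
    unfolding torus_zero_average_def
    using integrable_continuous[OF cont'] by (metis has_integral_integral)
qed

lemma torus_zero_average_add:
  assumes "torus_zero_average f" "torus_zero_average g"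
  shows "torus_zero_average (\<lambda>x y. f x y + g x y)"
  using has_integral_add[OF assms[unfolded torus_zero_average_def]]
  by (simp add: torus_zero_average_def case_prod_unfold)

lemma torus_zero_average_sum:
  assumes "finite I" "\<And>i. i \<in> I \<Longrightarrow> torus_zero_average (f i)"
  shows "torus_zero_average (\<lambda>x y. \<Sum>i\<in>I. f i x y)"
  using assms
  by (induction I) (simp_all add: torus_zero_average_add, simp add: torus_zero_average_def case_prod_unfold)

lemma has_integral_derivative_periodic:
  fixes g :: "real \<Rightarrow> real"
  assumes "\<And>x. (g has_field_derivative g' x) (at x)" "g (2*pi) = g 0"
  shows "(g' has_integral 0) {0..2*pi}"
proof -
  have "(g' has_integral (g (2*pi) - g 0)) {0..2*pi}"
    using assms(1)
    by (intro fundamental_theorem_of_calculus)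
      (auto simp flip: has_real_derivative_iff_has_vector_derivative intro: has_field_derivative_at_within)
  then show ?thesis using assms(2) by simp
qed

lemma continuous_on_C_k_slice:
  assumes "C_k n f"
  shows "continuous_on UNIV (\<lambda>(x, y). f t x y)"
proof -
  have "continuous_on UNIV ((\<lambda>(t, x, y). f t x y) \<circ> (\<lambda>(x, y). (t, x, y)))"
    by (intro continuous_on_compose continuous_on_subset[OF C_k_imp_continuous[OF assms]])
      (auto simp: case_prod_unfold intro!: continuous_intros)
  then show ?thesis by (simp add: case_prod_unfold o_def)
qed

text \<open>
  Each of the two second derivatives is the derivative of a periodic function, and so integrates
  to zero over a period.
\<close>

lemma torus_zero_average_laplacian:
  assumes C2: "C_k 2 f" and per: "torus_fun (f t)"
  shows "torus_zero_average (laplacian (f t))"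
proof -
  have C1: "C_k (Suc 0) (\<lambda>t. dx (f t))" "C_k (Suc 0) (\<lambda>t. dy (f t))"
    using C2 by (simp_all add: numeral_2_eq_2)
  have C0: "C_k 0 (\<lambda>t. dx (dx (f t)))" "C_k 0 (\<lambda>t. dy (dy (f t)))"
    using C1 by simp_all
  have xx: "torus_zero_average (dx (dx (f t)))"
  proof (rule torus_zero_average_if_slices)
    show "((\<lambda>x. dx (dx (f t)) x y) has_integral 0) {0..2*pi}" for y
      using torus_fun_dx[OF per]
      by (intro has_integral_derivative_periodic[OF C_k_has_partials(2)[OF C1(1)]])
        (metis torus_fun_iff add_0)
  qed (rule continuous_on_C_k_slice[OF C0(1)])
  have "torus_zero_average (\<lambda>y x. dy (dy (f t)) x y)"
  proof (rule torus_zero_average_if_slices)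
    show "((\<lambda>y. dy (dy (f t)) x y) has_integral 0) {0..2*pi}" for x
      using torus_fun_dy[OF per]
      by (intro has_integral_derivative_periodic[OF C_k_has_partials(3)[OF C1(2)]])
        (metis torus_fun_iff add_0)
    have "continuous_on UNIV ((\<lambda>(x, y). dy (dy (f t)) x y) \<circ> (\<lambda>(y, x). (x, y)))"
      by (intro continuous_on_compose continuous_on_subset[OF continuous_on_C_k_slice[OF C0(2)]])
        (auto simp: case_prod_unfold intro!: continuous_intros)
    then show "continuous_on UNIV (\<lambda>(y, x). dy (dy (f t)) x y)"
      by (simp add: case_prod_unfold o_def)
  qed
  then have yy: "torus_zero_average (dy (dy (f t)))"
    by (rule torus_zero_average_swap[OF continuous_on_C_k_slice[OF C0(2)]])
  show ?thesis
    using torus_zero_average_add[OF xx yy] by (simp add: laplacian_def)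
qed

lemma torus_zero_average_shear:
  assumes "smooth V" "circle_zero_average V"
  shows "torus_zero_average (\<lambda>x y. V x)"
  using assms
  by (intro torus_zero_average_if_slices)
    (auto simp: circle_zero_average_def case_prod_unfold
      intro!: continuous_on_compose2[OF smooth_continuous[of V UNIV]] continuous_intros)

section \<open>Periodisation of planar functions with small support\<close>

text \<open>
  The representative of \<open>s\<close> modulo \<open>2*pi\<close> in the interval from \<open>- pi\<close> to \<open>pi\<close>.
\<close>

definition principal :: "real \<Rightarrow> real" where
  "principal s = s - 2*pi * of_int (round (s / (2*pi)))"

lemma abs_principal_le_pi: "\<bar>principal s\<bar> \<le> pi"
proof -
  have "\<bar>principal s\<bar> = 2*pi * \<bar>of_int (round (s / (2*pi))) - s / (2*pi)\<bar>"
    by (simp add: principal_def abs_mult_pos' field_simps abs_minus_commute)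
  also have "\<dots> \<le> 2*pi * (1/2)"
    by (intro mult_left_mono of_int_round_abs_le) auto
  finally show ?thesis by simp
qed

lemma principal_plus_period: "principal (s + 2*pi) = principal s"
proof -
  have "(s + 2*pi) / (2*pi) = s / (2*pi) + of_int 1"
    by (simp add: field_simps)
  then have "round ((s + 2*pi) / (2*pi)) = round (s / (2*pi)) + 1"
    unfolding round_def by linarith
  then show ?thesis by (simp add: principal_def algebra_simps)
qed

lemma circle_dist_eq_abs_principal: "circle_dist s s' = \<bar>principal (s - s')\<bar>"
  unfolding circle_dist_def
proof (rule cInf_eq_minimum)
  show "\<bar>principal (s - s')\<bar> \<in> range (\<lambda>n. \<bar>s - s' - 2 * pi * of_int n\<bar>)"
    by (auto simp: principal_def)
next
  fix d assume "d \<in> range (\<lambda>n. \<bar>s - s' - 2 * pi * of_int n\<bar>)"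
  then obtain n :: int where d: "d = \<bar>s - s' - 2*pi * of_int n\<bar>" by auto
  have scale: "\<bar>s - s' - 2*pi * r\<bar> = 2*pi * \<bar>(s - s') / (2*pi) - r\<bar>" for r
    by (simp add: abs_mult_pos' field_simps)
  show "\<bar>principal (s - s')\<bar> \<le> d"
    unfolding d principal_def scale by (intro mult_left_mono round_diff_minimal) auto
qed

text \<open>
  The function \<open>principal\<close> jumps at the odd multiples of \<open>pi\<close>.  Near a point \<open>z\<close> it nevertheless
  agrees with the translation that is exact at \<open>z\<close>, except where both of them have absolute value
  at least \<open>R\<close>; a function that vanishes there does not see the jump.
\<close>

lemma principal_near:
  assumes "0 \<le> R" and near: "\<bar>x - z\<bar> < pi - R"
  defines "x' \<equiv> x - 2*pi * of_int (round (z / (2*pi)))"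
  shows "principal x = x' \<or> R \<le> \<bar>principal x\<bar> \<and> R \<le> \<bar>x'\<bar>"
proof -
  define n where "n = round (x / (2*pi)) - round (z / (2*pi))"
  have eq: "principal x = x' - 2*pi * of_int n"
    by (simp add: principal_def x'_def n_def algebra_simps)
  have bound: "\<bar>x'\<bar> < 2*pi - R"
    using near abs_principal_le_pi[of z] by (auto simp: x'_def principal_def)
  show ?thesis
  proof (cases "n = 0")
    case False
    then have "1 \<le> \<bar>n\<bar>" by simp
    then have "(1::real) \<le> \<bar>of_int n\<bar>" by linarith
    then have "2*pi \<le> \<bar>2*pi * of_int n\<bar>" by (simp add: abs_mult)
    then show ?thesis
      using eq bound abs_principal_le_pi[of x] by linarith
  qed (simp add: eq)
qed

text \<open>
  The \<open>2*pi\<close>-periodic function in both variables that agrees with \<open>f\<close> on the open square of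
  half-width \<open>pi\<close>, moved by \<open>c\<close> in the direction of \<open>x\<close>.
\<close>

definition wrap :: "real \<Rightarrow> (real \<Rightarrow> real \<Rightarrow> real) \<Rightarrow> real \<Rightarrow> real \<Rightarrow> real" where
  "wrap c f = (\<lambda>x y. f (principal (x - c)) (principal y))"

lemma torus_fun_wrap: "torus_fun (wrap c f)"
proof -
  have "principal (x + 2*pi - c) = principal (x - c)" for x
    using principal_plus_period[of "x - c"] by (simp add: algebra_simps)
  then show ?thesis
    by (simp add: torus_fun_iff wrap_def principal_plus_period)
qed

text \<open>
  The bound \<open>R < pi\<close> keeps the support away from the boundary of the fundamental square, which is
  the seam of \<open>wrap\<close>.
\<close>

definition lives_in_square :: "real \<Rightarrow> (real \<Rightarrow> real \<Rightarrow> real) \<Rightarrow> bool" where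
  "lives_in_square R f \<longleftrightarrow> 0 \<le> R \<and> R < pi \<and> (\<forall>x y. R \<le> \<bar>x\<bar> \<or> R \<le> \<bar>y\<bar> \<longrightarrow> f x y = 0)"

text \<open>
  The radius \<open>pi - R\<close> does not depend on the point, and at the point itself the translation is the
  one used by \<open>wrap\<close>.  Hence continuity and derivatives of \<open>f\<close> carry over, and \<open>wrap\<close> commutes with
  differentiation.
\<close>

lemma wrap_eq_planar_near:
  assumes "lives_in_square R f" "\<bar>x - x0\<bar> < pi - R" "\<bar>y - y0\<bar> < pi - R"
  shows "wrap c f x y = f (x - c - 2*pi * of_int (round ((x0 - c) / (2*pi))))
                          (y - 2*pi * of_int (round (y0 / (2*pi))))"
  using principal_near[of R "x - c" "x0 - c"] principal_near[of R y y0] assms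
  unfolding lives_in_square_def wrap_def by (auto; metis)

lemma continuous_on_wrap:
  assumes sq: "lives_in_square R f" and cont: "continuous_on UNIV (\<lambda>(x, y). f x y)"
  shows "continuous_on UNIV (\<lambda>(x, y). wrap c f x y)"
proof (clarsimp simp: continuous_on_eq_continuous_at)
  fix x0 y0
  define m n where "m = c + 2*pi * of_int (round ((x0 - c) / (2*pi)))"
    and "n = 2*pi * of_int (round (y0 / (2*pi)))"
  have "continuous_on UNIV ((\<lambda>(x, y). f x y) \<circ> (\<lambda>(x, y). (x - m, y - n)))"
    by (intro continuous_on_compose continuous_on_subset[OF cont])
      (auto simp: case_prod_unfold intro!: continuous_intros)
  then have planar: "isCont (\<lambda>(x, y). f (x - m) (y - n)) (x0, y0)"
    by (simp add: continuous_on_eq_continuous_at case_prod_unfold o_def)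
  have "\<forall>\<^sub>F p in nhds (x0, y0). dist p (x0, y0) < pi - R"
    unfolding eventually_nhds_metric
    by (rule exI[of _ "pi - R"]) (use sq in \<open>simp add: lives_in_square_def\<close>)
  then have "\<forall>\<^sub>F p in nhds (x0, y0). (\<lambda>(x, y). f (x - m) (y - n)) p = (\<lambda>(x, y). wrap c f x y) p"
  proof eventually_elim
    case (elim p)
    then have "\<bar>fst p - x0\<bar> < pi - R" "\<bar>snd p - y0\<bar> < pi - R"
      using dist_fst_le[of p "(x0, y0)"] dist_snd_le[of p "(x0, y0)"]
      by (auto simp: dist_real_def)
    from wrap_eq_planar_near[OF sq this, of c]
    show ?case by (simp add: case_prod_unfold m_def n_def algebra_simps)
  qed
  then show "isCont (\<lambda>(x, y). wrap c f x y) (x0, y0)"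
    using planar isCont_cong by blast
qed

lemma wrap_has_partials:
  assumes sq: "lives_in_square R f"
    and fx: "\<And>x y. ((\<lambda>s. f s y) has_field_derivative fx x y) (at x)"
    and fy: "\<And>x y. ((\<lambda>s. f x s) has_field_derivative fy x y) (at y)"
  shows "((\<lambda>s. wrap c f s y) has_field_derivative wrap c fx x y) (at x)"
    and "((\<lambda>s. wrap c f x s) has_field_derivative wrap c fy x y) (at y)"
proof -
  have pos: "0 < pi - R" using sq by (simp add: lives_in_square_def)
  define m n where "m = c + 2*pi * of_int (round ((x - c) / (2*pi)))"
    and "n = 2*pi * of_int (round (y / (2*pi)))"
  have at_centre: "principal (x - c) = x - m" "principal y = y - n"
    by (simp_all add: m_def n_def principal_def)
  have "((\<lambda>s. f (s - m) (y - n)) has_field_derivative wrap c fx x y) (at x)"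
    unfolding wrap_def at_centre
    by (rule DERIV_chain'[OF _ fx, THEN DERIV_cong]) (auto intro!: derivative_eq_intros)
  then show "((\<lambda>s. wrap c f s y) has_field_derivative wrap c fx x y) (at x)"
    by (rule has_field_derivative_transform_within[OF _ pos])
      (use pos wrap_eq_planar_near[OF sq, of _ x y y c] in
        \<open>auto simp: dist_real_def m_def n_def algebra_simps\<close>)
  have "((\<lambda>s. f (x - m) (s - n)) has_field_derivative wrap c fy x y) (at y)"
    unfolding wrap_def at_centre
    by (rule DERIV_chain'[OF _ fy, THEN DERIV_cong]) (auto intro!: derivative_eq_intros)
  then show "((\<lambda>s. wrap c f x s) has_field_derivative wrap c fy x y) (at y)"
    by (rule has_field_derivative_transform_within[OF _ pos])
      (use pos wrap_eq_planar_near[OF sq, of x x _ y c] in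
        \<open>auto simp: dist_real_def m_def n_def algebra_simps\<close>)
qed

section \<open>Powers of the radial cap\<close>

lemma has_derivative_positive_part_power:
  "((\<lambda>u. max 0 u ^ Suc (Suc n)) has_field_derivative real (Suc (Suc n)) * max 0 u ^ Suc n) (at u)"
  for u :: real
proof -
  consider "u < 0" | "u = 0" | "u > 0" by linarith
  then show ?thesis
  proof cases
    case 1
    have "((\<lambda>u::real. 0) has_field_derivative real (Suc (Suc n)) * max 0 u ^ Suc n) (at u)"
      using 1 by (simp add: max_def)
    then show ?thesis
      by (rule has_field_derivative_transform_within_open[of _ _ _ "{..<0}"]) (use 1 in \<open>auto simp: max_def\<close>)
  next
    case 2
    have "((\<lambda>h::real. max 0 h ^ Suc n) \<longlongrightarrow> max 0 0 ^ Suc n) (at 0)"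
      by (intro tendsto_intros)
    moreover have "\<forall>\<^sub>F h::real in at 0. max 0 h ^ Suc n = (max 0 (0 + h) ^ Suc (Suc n) - max 0 0 ^ Suc (Suc n)) / h"
      by (auto simp: eventually_at_filter max_def)
    ultimately show ?thesis
      unfolding DERIV_def 2 by (auto intro: Lim_transform_eventually)
  next
    case 3
    have "((\<lambda>u. u ^ Suc (Suc n)) has_field_derivative real (Suc (Suc n)) * max 0 u ^ Suc n) (at u)"
      using 3 by (auto intro!: derivative_eq_intros simp: max_def simp del: power_Suc)
    then show ?thesis
      by (rule has_field_derivative_transform_within_open[of _ _ _ "{0<..}"]) (use 3 in \<open>auto simp: max_def\<close>)
  qed
qed

definition cap :: "real \<Rightarrow> real \<Rightarrow> real \<Rightarrow> real" where
  "cap R x y = max 0 (R\<^sup>2 - x\<^sup>2 - y\<^sup>2)"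

lemma cap_eq_0: "R \<le> \<bar>x\<bar> \<or> R \<le> \<bar>y\<bar> \<Longrightarrow> 0 \<le> R \<Longrightarrow> cap R x y = 0"
  using power_mono[of R "\<bar>x\<bar>" 2] power_mono[of R "\<bar>y\<bar>" 2] unfolding cap_def
  by (auto simp: max_def) (smt (verit) zero_le_power2)+

definition cap_monomial :: "real \<Rightarrow> nat \<Rightarrow> nat \<Rightarrow> nat \<Rightarrow> real \<Rightarrow> real \<Rightarrow> real" where
  "cap_monomial R p i j = (\<lambda>x y. cap R x y ^ p * x ^ i * y ^ j)"

lemma cap_monomial_swap: "cap_monomial R p i j x y = cap_monomial R p j i y x"
  by (simp add: cap_monomial_def cap_def algebra_simps)

lemma continuous_cap_monomial: "continuous_on UNIV (\<lambda>(x, y). cap_monomial R p i j x y)"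
  unfolding cap_monomial_def cap_def case_prod_unfold by (intro continuous_intros)

lemma cap_monomial_lives_in_square:
  assumes "0 \<le> R" "R < pi"
  shows "lives_in_square R (cap_monomial R (Suc p) i j)"
  using assms cap_eq_0[of R] by (auto simp: lives_in_square_def cap_monomial_def)

text \<open>
  For \<open>p \<ge> 2\<close>, the partial derivatives of the products \<open>w\<^sup>p x\<^sup>i y\<^sup>j\<close>, where \<open>w\<close> is the cap, are again
  combinations of such products, with \<open>p\<close> lowered by at most one.  So the exponent of \<open>w\<close> counts the
  derivatives that exist.  For \<open>i = 0\<close> the truncated exponent \<open>i - 1\<close> is harmless, as its coefficient
  is zero.
\<close>

lemma cap_monomial_has_partial_x:
  "((\<lambda>s. cap_monomial R (Suc (Suc p)) i j s y) has_field_derivative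
     -2 * real (Suc (Suc p)) * cap_monomial R (Suc p) (Suc i) j x y
       + real i * cap_monomial R (Suc (Suc p)) (i - 1) j x y) (at x)"
proof -
  have "((\<lambda>s. R\<^sup>2 - s\<^sup>2 - y\<^sup>2) has_field_derivative - 2 * x) (at x)"
    by (auto intro!: derivative_eq_intros)
  note cap' = DERIV_chain'[OF this has_derivative_positive_part_power[of p]]
  have i: "((\<lambda>s. s ^ i) has_field_derivative real i * x ^ (i - 1)) (at x)"
    by (auto intro!: derivative_eq_intros)
  show ?thesis
    unfolding cap_monomial_def cap_def
    by (rule DERIV_cong[OF DERIV_cmult_right[OF DERIV_mult[OF cap' i]]])
      (simp add: algebra_simps)
qed

lemma cap_monomial_has_partial_y:
  "((\<lambda>s. cap_monomial R (Suc (Suc p)) i j x s) has_field_derivative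
     -2 * real (Suc (Suc p)) * cap_monomial R (Suc p) i (Suc j) x y
       + real j * cap_monomial R (Suc (Suc p)) i (j - 1) x y) (at y)"
  using cap_monomial_has_partial_x[of R p j i x y]
  unfolding cap_monomial_swap[of R _ i j x] cap_monomial_swap[of R _ i "Suc j" x]
    cap_monomial_swap[of R _ i "j - 1" x] .

lemma wrap_linear: "wrap c (\<lambda>x y. r * f x y + s * g x y) = (\<lambda>x y. r * wrap c f x y + s * wrap c g x y)"
  by (simp add: wrap_def)

lemma wrapped_cap_monomial_has_partials:
  assumes "0 \<le> R" "R < pi"
  shows "((\<lambda>s. wrap c (cap_monomial R (Suc (Suc p)) i j) s y) has_field_derivative
          -2 * real (Suc (Suc p)) * wrap c (cap_monomial R (Suc p) (Suc i) j) x y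
            + real i * wrap c (cap_monomial R (Suc (Suc p)) (i - 1) j) x y) (at x)" (is ?X)
    and "((\<lambda>s. wrap c (cap_monomial R (Suc (Suc p)) i j) x s) has_field_derivative
          -2 * real (Suc (Suc p)) * wrap c (cap_monomial R (Suc p) i (Suc j)) x y
            + real j * wrap c (cap_monomial R (Suc (Suc p)) i (j - 1)) x y) (at y)" (is ?Y)
proof -
  note partials = wrap_has_partials[OF cap_monomial_lives_in_square[OF assms]
      cap_monomial_has_partial_x cap_monomial_has_partial_y, unfolded wrap_linear]
  show ?X by (rule partials)
  show ?Y by (rule partials)
qed

lemma C_k_wrapped_cap_monomial:
  assumes "0 \<le> R" "R < pi" "n < p"
  shows "C_k n (\<lambda>t. wrap c (cap_monomial R p i j))"
  using assms(3)
proof (induction n arbitrary: p i j)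
  have cont: "continuous_on UNIV (\<lambda>(t::real, x, y). wrap c (cap_monomial R p i j) x y)" if "0 < p" for p i j
  proof -
    from that obtain q where q: "p = Suc q" by (cases p) auto
    have "continuous_on UNIV ((\<lambda>(x, y). wrap c (cap_monomial R p i j) x y) \<circ> (\<lambda>(t::real, p). p))"
      unfolding q
      by (intro continuous_on_compose continuous_on_subset[OF continuous_on_wrap[OF
            cap_monomial_lives_in_square[OF assms(1,2)] continuous_cap_monomial]])
        (auto simp: case_prod_unfold intro!: continuous_intros)
    then show ?thesis by (simp add: case_prod_unfold o_def)
  qed
  {
    case 0
    show ?case unfolding C_k.simps by (rule cont[OF 0])
  next
    case (Suc n)
    define q where "q = p - 2"
    have p: "p = Suc (Suc q)" and q: "n < Suc q"
      using Suc.prems by (simp_all add: q_def)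
    have C: "C_k n (\<lambda>t x y. a * wrap c (cap_monomial R (Suc q) i1 j1) x y + b * wrap c (cap_monomial R (Suc (Suc q)) i2 j2) x y)"
      for a b i1 j1 i2 j2
      using q by (intro C_k_add C_k_scale Suc.IH) auto
    show ?case
      unfolding p
    proof (rule C_k_SucI)
      show "continuous_on UNIV (\<lambda>(t::real, x, y). wrap c (cap_monomial R (Suc (Suc q)) i j) x y)"
        by (rule cont) simp
      show "((\<lambda>s. wrap c (cap_monomial R (Suc (Suc q)) i j) x y) has_field_derivative 0) (at t)" for t x y
        by (rule DERIV_const)
    next
      fix x y
      note partials = wrapped_cap_monomial_has_partials[OF assms(1,2), of c q i j]
      show "((\<lambda>s. wrap c (cap_monomial R (Suc (Suc q)) i j) s y) has_field_derivative
          -2 * real (Suc (Suc q)) * wrap c (cap_monomial R (Suc q) (Suc i) j) x y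
            + real i * wrap c (cap_monomial R (Suc (Suc q)) (i - 1) j) x y) (at x)"
        by (rule partials)
      show "((\<lambda>s. wrap c (cap_monomial R (Suc (Suc q)) i j) x s) has_field_derivative
          -2 * real (Suc (Suc q)) * wrap c (cap_monomial R (Suc q) i (Suc j)) x y
            + real j * wrap c (cap_monomial R (Suc (Suc q)) i (j - 1)) x y) (at y)"
        by (rule partials)
    next
      show "C_k n (\<lambda>t x y. -2 * real (Suc (Suc q)) * wrap c (cap_monomial R (Suc q) (Suc i) j) x y
            + real i * wrap c (cap_monomial R (Suc (Suc q)) (i - 1) j) x y)"
        "C_k n (\<lambda>t x y. -2 * real (Suc (Suc q)) * wrap c (cap_monomial R (Suc q) i (Suc j)) x y
            + real j * wrap c (cap_monomial R (Suc (Suc q)) i (j - 1)) x y)"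
        by (rule C)+
    qed (rule C_k_zero)
  }
qed

definition cap_power :: "real \<Rightarrow> real \<Rightarrow> nat \<Rightarrow> real \<Rightarrow> real \<Rightarrow> real" where
  "cap_power R c p = wrap c (cap_monomial R p 0 0)"

lemma wrap_cap_monomial_eq:
  "wrap c (cap_monomial R p i j) x y = principal (x - c) ^ i * principal y ^ j * cap_power R c p x y"
  by (simp add: wrap_def cap_monomial_def cap_power_def)

lemma cap_power_gradient:
  assumes "0 \<le> R" "R < pi"
  shows "dx (cap_power R c (Suc (Suc p))) =
           (\<lambda>x y. -2 * real (Suc (Suc p)) * wrap c (cap_monomial R (Suc p) 1 0) x y)"
    and "dy (cap_power R c (Suc (Suc p))) =
           (\<lambda>x y. -2 * real (Suc (Suc p)) * wrap c (cap_monomial R (Suc p) 0 1) x y)"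
  using wrapped_cap_monomial_has_partials[OF assms, of c p 0 0, THEN DERIV_imp_deriv]
  by (simp_all add: dx_def dy_def cap_power_def)

text \<open>
  In terms of \<open>w = R\<^sup>2 - r\<^sup>2\<close> one has \<open>\<Delta> w\<^sup>q = 4 q (q - 1) r\<^sup>2 w\<^sup>q\<^sup>-\<^sup>2 - 4 q w\<^sup>q\<^sup>-\<^sup>1\<close>; replacing \<open>r\<^sup>2\<close> by
  \<open>R\<^sup>2 - w\<close> leaves a combination of powers of \<open>w\<close>.  Here \<open>q = p + 3\<close>, so that the exponents on the
  right are positive.
\<close>

lemma laplacian_cap_power:
  assumes "0 \<le> R" "R < pi"
  shows "laplacian (cap_power R c (p + 3)) =
    (\<lambda>x y. (4 * real (p + 3) * real (p + 2) * R\<^sup>2) * cap_power R c (p + 1) x y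
          + (- 4 * (real (p + 3))\<^sup>2) * cap_power R c (p + 2) x y)"
proof (intro ext)
  fix x y
  have exps: "p + 3 = Suc (Suc (Suc p))" "p + 2 = Suc (Suc p)" "p + 1 = Suc p" by auto
  note partials = wrapped_cap_monomial_has_partials[OF assms, of c p,
      THEN DERIV_cmult, THEN DERIV_imp_deriv]
  have xx: "dx (dx (cap_power R c (p + 3))) x y = (- 2 * real (p + 3)) *
      (- 2 * real (p + 2) * wrap c (cap_monomial R (p + 1) 2 0) x y + cap_power R c (p + 2) x y)"
    unfolding exps cap_power_gradient[OF assms] unfolding dx_def partials
    by (simp add: cap_power_def numeral_2_eq_2)
  have yy: "dy (dy (cap_power R c (p + 3))) x y = (- 2 * real (p + 3)) *
      (- 2 * real (p + 2) * wrap c (cap_monomial R (p + 1) 0 2) x y + cap_power R c (p + 2) x y)"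
    unfolding exps cap_power_gradient[OF assms] unfolding dy_def partials
    by (simp add: cap_power_def numeral_2_eq_2)
  define X Y where "X = principal (x - c)" and "Y = principal y"
  \<comment> \<open>The identity \<open>r\<^sup>2 w = R\<^sup>2 w - w\<^sup>2\<close> also holds outside the disc, where \<open>w = 0\<close>.\<close>
  have "cap R X Y ^ (p + 2) = cap R X Y ^ p * (cap R X Y * cap R X Y)"
    by simp
  also have "cap R X Y * cap R X Y = (R\<^sup>2 - X\<^sup>2 - Y\<^sup>2) * cap R X Y"
    by (simp add: cap_def max_def)
  finally have "(X\<^sup>2 + Y\<^sup>2) * cap_power R c (p + 1) x y =
      R\<^sup>2 * cap_power R c (p + 1) x y - cap_power R c (p + 2) x y"
    unfolding cap_power_def wrap_def cap_monomial_def X_def[symmetric] Y_def[symmetric]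
    by (simp only: power_0 mult_1_right) (simp add: algebra_simps)
  then have squares: "wrap c (cap_monomial R (p + 1) 2 0) x y + wrap c (cap_monomial R (p + 1) 0 2) x y =
      R\<^sup>2 * cap_power R c (p + 1) x y - cap_power R c (p + 2) x y"
    by (simp add: wrap_cap_monomial_eq X_def Y_def algebra_simps)
  have "laplacian (cap_power R c (p + 3)) x y =
      4 * real (p + 3) * real (p + 2) *
        (wrap c (cap_monomial R (p + 1) 2 0) x y + wrap c (cap_monomial R (p + 1) 0 2) x y)
      - 4 * real (p + 3) * cap_power R c (p + 2) x y"
    unfolding laplacian_def xx yy by (simp add: algebra_simps)
  then show "laplacian (cap_power R c (p + 3)) x y =
      (4 * real (p + 3) * real (p + 2) * R\<^sup>2) * cap_power R c (p + 1) x y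
          + (- 4 * (real (p + 3))\<^sup>2) * cap_power R c (p + 2) x y"
    unfolding squares by (simp add: algebra_simps power2_eq_square)
qed

text \<open>
  The gradient points along the position vector relative to \<open>(c, 0)\<close>, as it does for a function
  that is radial around this point.
\<close>

definition central_gradient :: "real \<Rightarrow> (real \<Rightarrow> real \<Rightarrow> real) \<Rightarrow> bool" where
  "central_gradient c f \<longleftrightarrow>
     (\<exists>q. \<forall>x y. dx f x y = principal (x - c) * q x y \<and> dy f x y = principal y * q x y)"

lemma poisson_bracket_central:
  assumes "central_gradient c f" "central_gradient c g"
  shows "poisson_bracket f g x y = 0"
  using assms by (auto simp: central_gradient_def poisson_bracket_def)

lemma central_gradient_cap_power:
  assumes "0 \<le> R" "R < pi" "2 \<le> p"
  shows "central_gradient c (cap_power R c p)"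
proof -
  from assms(3) obtain q where p: "p = Suc (Suc q)"
    by (auto simp: le_iff_add)
  show ?thesis
    unfolding central_gradient_def p cap_power_gradient[OF assms(1,2)] wrap_cap_monomial_eq
    by (rule exI[of _ "\<lambda>x y. - 2 * real (Suc (Suc q)) * cap_power R c (Suc q) x y"]) simp
qed

lemma central_gradient_linear:
  assumes C: "C_k (Suc n) (\<lambda>t. f)" "C_k (Suc n) (\<lambda>t. g)"
    and "central_gradient c f" "central_gradient c g"
  shows "central_gradient c (\<lambda>x y. r * f x y + s * g x y)"
proof -
  obtain q q' where
    "dx f x y = principal (x - c) * q x y" "dy f x y = principal y * q x y"
    "dx g x y = principal (x - c) * q' x y" "dy g x y = principal y * q' x y" for x y
    using assms(3,4) unfolding central_gradient_def by metis
  then show ?thesis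
    unfolding central_gradient_def dx_linear[OF C] dy_linear[OF C]
    by (intro exI[of _ "\<lambda>x y. r * q x y + s * q' x y"]) (simp add: algebra_simps)
qed

lemma radially_symmetric_cap_power:
  "radially_symmetric_around (cap_power R c p) (c, 0)"
  unfolding radially_symmetric_around_def
proof (intro exI[of _ "\<lambda>d. max 0 (R\<^sup>2 - d\<^sup>2) ^ p"] allI)
  fix x y
  have "(torus_dist (x, y) (c, 0))\<^sup>2 = (principal (x - c))\<^sup>2 + (principal y)\<^sup>2"
    by (simp add: torus_dist_def circle_dist_eq_abs_principal)
  then show "cap_power R c p x y = max 0 (R\<^sup>2 - (torus_dist (x, y) (c, 0))\<^sup>2) ^ p"
    by (simp add: cap_power_def wrap_def cap_monomial_def cap_def diff_diff_eq)
qed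

lemma radially_symmetric_linear:
  assumes "radially_symmetric_around f c" "radially_symmetric_around g c"
  shows "radially_symmetric_around (\<lambda>x y. r * f x y + s * g x y) c"
proof -
  obtain f' g' where "f x y = f' (torus_dist (x, y) c)" "g x y = g' (torus_dist (x, y) c)" for x y
    using assms unfolding radially_symmetric_around_def by metis
  then show ?thesis
    unfolding radially_symmetric_around_def
    by (intro exI[of _ "\<lambda>d. r * f' d + s * g' d"]) simp
qed

lemma cap_power_eq_0:
  assumes "0 \<le> R" "R \<le> \<bar>principal (x - c)\<bar>" "0 < p"
  shows "cap_power R c p x y = 0"
  using assms by (simp add: cap_power_def wrap_def cap_monomial_def cap_eq_0)

text \<open>
  The margins between \<open>c - R\<close> and \<open>a\<close> and between \<open>c + R\<close> and \<open>b\<close> absorb the passage to the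
  closure.
\<close>

lemma torus_support_subset_strip:
  assumes vanish: "\<And>x y. R \<le> \<bar>principal (x - c)\<bar> \<Longrightarrow> f x y = 0"
    and "a < c - R" "c + R < b"
  shows "torus_support f \<subseteq> torus_strip a b"
proof clarify
  fix x y assume "(x, y) \<in> torus_support f"
  define d where "d = min (c - R - a) (b - c - R)"
  have "0 < d" using assms(2,3) by (simp add: d_def)
  with \<open>(x, y) \<in> torus_support f\<close> obtain x' y' where "f x' y' \<noteq> 0" "dist (x', y') (x, y) < d"
    unfolding torus_support_def closure_approachable by force
  then have "\<bar>principal (x' - c)\<bar> < R" "\<bar>x' - x\<bar> < d"
    using vanish[of x' y'] dist_fst_le[of "(x', y')" "(x, y)"] by (force simp: dist_real_def)+
  then have "x - 2*pi * of_int (round ((x' - c) / (2*pi))) \<in> {a<..<b}"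
    by (auto simp: principal_def d_def)
  then show "(x, y) \<in> torus_strip a b"
    by (auto simp: torus_strip_def)
qed

text \<open>
  A stationary solution of the Euler equation whose stream function and vorticity are both
  supported in a strip.  That \<open>\<Psi>\<close> is itself a Laplacian is the form in which its zero average is
  recorded: this form is inherited by the translates of \<open>\<Psi>\<close>.
\<close>

definition steady_vortex ::
    "real \<Rightarrow> real \<Rightarrow> (real \<Rightarrow> real \<Rightarrow> real) \<Rightarrow> (real \<Rightarrow> real \<Rightarrow> real) \<Rightarrow> bool" where
  "steady_vortex a b \<Psi> \<Omega> \<longleftrightarrow>
     C_k 2 (\<lambda>t. \<Psi>) \<and> C_k 1 (\<lambda>t. \<Omega>) \<and> torus_fun \<Psi> \<and> torus_fun \<Omega> \<and>
     laplacian \<Psi> = \<Omega> \<and> (\<forall>x y. poisson_bracket \<Psi> \<Omega> x y = 0) \<and>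
     (\<exists>\<Phi>. C_k 2 (\<lambda>t. \<Phi>) \<and> torus_fun \<Phi> \<and> laplacian \<Phi> = \<Psi>) \<and>
     torus_support \<Psi> \<subseteq> torus_strip a b \<and> torus_support \<Omega> \<subseteq> torus_strip a b"

lemma torus_fun_linear:
  assumes "torus_fun f" "torus_fun g"
  shows "torus_fun (\<lambda>x y. r * f x y + s * g x y :: real)"
  using assms by (simp add: torus_fun_iff)

lemma C_k_linear:
  assumes "C_k n (\<lambda>t. f)" "C_k n (\<lambda>t. g)"
  shows "C_k n (\<lambda>t x y. r * f x y + s * g x y)"
  using assms by (intro C_k_add C_k_scale)

text \<open>
  With \<open>\<Phi> = w\<^sup>6\<close>, the functions \<open>\<Psi> = \<Delta>\<Phi>\<close> and \<open>\<Omega> = \<Delta>\<Psi>\<close> take the values \<open>- 24 R\<^sup>1\<^sup>0\<close> and \<open>960 R\<^sup>8\<close> at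
  the centre, and so neither of them is zero.
\<close>

lemma exists_radial_steady_vortex:
  assumes "a < b" "b - a \<le> 2*pi"
  obtains \<Psi> \<Omega> where "steady_vortex a b \<Psi> \<Omega>"
    "radially_symmetric_around \<Psi> ((a + b) / 2, 0)" "radially_symmetric_around \<Omega> ((a + b) / 2, 0)"
    "\<Psi> \<noteq> (\<lambda>x y. 0)" "\<Omega> \<noteq> (\<lambda>x y. 0)"
proof -
  \<comment> \<open>A quarter of the width leaves room on both sides of the disc and keeps \<open>R\<close> below \<open>pi\<close>.\<close>
  define R c where "R = (b - a) / 4" and "c = (a + b) / 2"
  have R: "0 < R" "0 \<le> R" "R < pi" and strip: "a < c - R" "c + R < b"
    using assms pi_gt_zero by (auto simp: R_def c_def field_simps)
  define L where "L p = laplacian (cap_power R c (p + 3))" for p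
  define \<Psi> \<Omega> where "\<Psi> = L 3" and "\<Omega> = laplacian \<Psi>"
  note L = L_def[unfolded laplacian_cap_power[OF R(2,3)]]
  have C: "C_k n (\<lambda>t. cap_power R c p)" if "n < p" for n p
    unfolding cap_power_def by (rule C_k_wrapped_cap_monomial[OF R(2,3) that])
  have CL: "C_k n (\<lambda>t. L p)" if "n \<le> p" for n p
    unfolding L using that by (intro C_k_linear C) auto
  have \<Psi>: "\<Psi> = (\<lambda>x y. (120 * R\<^sup>2) * cap_power R c 4 x y + (-144) * cap_power R c 5 x y)"
    unfolding \<Psi>_def L by simp
  have "laplacian (cap_power R c 4) = L 1" "laplacian (cap_power R c 5) = L 2"
    unfolding L_def by simp_all
  then have \<Omega>: "\<Omega> = (\<lambda>x y. (120 * R\<^sup>2) * L 1 x y + (-144) * L 2 x y)"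
    unfolding \<Omega>_def \<Psi> by (subst laplacian_linear) (simp_all add: C)
  have radial: "radially_symmetric_around (L p) (c, 0)" for p
    unfolding L by (intro radially_symmetric_linear radially_symmetric_cap_power)
  have vanish: "L p x y = 0" if "R \<le> \<bar>principal (x - c)\<bar>" for p x y
    using cap_power_eq_0[OF R(2) that] by (simp add: L)
  have per: "torus_fun (L p)" for p
    unfolding L cap_power_def by (intro torus_fun_linear torus_fun_wrap)
  have central: "central_gradient c (L p)" if "1 \<le> p" for p
    unfolding L using that R
    by (intro central_gradient_linear[where n = 0] C central_gradient_cap_power) auto
  have at_centre: "cap_power R c p c 0 = R ^ (2 * p)" for p
    by (simp add: cap_power_def wrap_def cap_monomial_def cap_def principal_def power_mult)
  have "steady_vortex a b \<Psi> \<Omega>"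
    unfolding steady_vortex_def
  proof (intro conjI exI allI)
    show "C_k 2 (\<lambda>t. \<Psi>)" unfolding \<Psi>_def by (rule CL) simp
    show "C_k 1 (\<lambda>t. \<Omega>)" unfolding \<Omega> by (intro C_k_linear CL) simp_all
    show "torus_fun \<Psi>" unfolding \<Psi>_def by (rule per)
    show "torus_fun \<Omega>" unfolding \<Omega> by (intro torus_fun_linear per)
    show "laplacian \<Psi> = \<Omega>" by (simp add: \<Omega>_def)
    show "poisson_bracket \<Psi> \<Omega> x y = 0" for x y
    proof (rule poisson_bracket_central)
      show "central_gradient c \<Psi>" unfolding \<Psi>_def by (rule central) simp
      show "central_gradient c \<Omega>"
        unfolding \<Omega> by (intro central_gradient_linear[where n = 0] CL central) simp_all
    qed
    show "C_k 2 (\<lambda>t. cap_power R c 6)" by (rule C) simp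
    show "torus_fun (cap_power R c 6)" unfolding cap_power_def by (rule torus_fun_wrap)
    show "laplacian (cap_power R c 6) = \<Psi>" by (simp add: \<Psi>_def L_def)
    show "torus_support \<Psi> \<subseteq> torus_strip a b" unfolding \<Psi>_def
      by (rule torus_support_subset_strip[OF vanish strip])
    show "torus_support \<Omega> \<subseteq> torus_strip a b"
      by (rule torus_support_subset_strip[OF _ strip]) (simp add: \<Omega> vanish)
  qed
  moreover have "\<Psi> c 0 = - 24 * R ^ 10"
    by (simp add: \<Psi> at_centre flip: power_add)
  then have "\<Psi> \<noteq> (\<lambda>x y. 0)" using R(1) by auto
  moreover have "\<Omega> c 0 = 960 * R ^ 8"
    by (simp add: \<Omega> L at_centre) (simp add: eval_nat_numeral algebra_simps)
  then have "\<Omega> \<noteq> (\<lambda>x y. 0)" using R(1) by auto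
  moreover have "radially_symmetric_around \<Psi> (c, 0)" "radially_symmetric_around \<Omega> (c, 0)"
    unfolding \<Omega> unfolding \<Psi>_def by (intro radial radially_symmetric_linear)+
  ultimately show thesis
    using that unfolding c_def by blast
qed

section \<open>Shear flow plus travelling perturbations\<close>

text \<open>
  The summand \<open>h\<close> stands for the shear flow; it contributes to the derivative in \<open>x\<close> only.
\<close>

lemma superposition_partials:
  fixes f :: "'i \<Rightarrow> real \<Rightarrow> real \<Rightarrow> real" and v :: "'i \<Rightarrow> real"
  assumes I: "finite I" and f: "\<And>k. k \<in> I \<Longrightarrow> C_k (Suc n) (\<lambda>t. f k)"
    and h: "\<And>x. (h has_field_derivative h' x) (at x)"
  defines "F \<equiv> \<lambda>t x y. h x + (\<Sum>k\<in>I. f k x (y - v k * t))"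
  shows "dt F t x y = (\<Sum>k\<in>I. - v k * dy (f k) x (y - v k * t))"
    and "dx (F t) = (\<lambda>x y. h' x + (\<Sum>k\<in>I. dx (f k) x (y - v k * t)))"
    and "dy (F t) = (\<lambda>x y. \<Sum>k\<in>I. dy (f k) x (y - v k * t))"
proof -
  note partials = C_k_has_partials[OF f]
  have "((\<lambda>s. f k x (y - v k * s)) has_field_derivative - v k * dy (f k) x (y - v k * t)) (at t)"
    if "k \<in> I" for k
    by (rule DERIV_chain'[OF _ partials(3)[OF that], THEN DERIV_cong]) (auto intro!: derivative_eq_intros)
  then have "((\<lambda>s. F s x y) has_field_derivative 0 + (\<Sum>k\<in>I. - v k * dy (f k) x (y - v k * t))) (at t)"
    unfolding F_def by (intro DERIV_add DERIV_const DERIV_sum)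
  then show "dt F t x y = (\<Sum>k\<in>I. - v k * dy (f k) x (y - v k * t))"
    unfolding dt_def by (simp add: DERIV_imp_deriv)
  show "dx (F t) = (\<lambda>x y. h' x + (\<Sum>k\<in>I. dx (f k) x (y - v k * t)))"
  proof (intro ext)
    fix x y
    have "((\<lambda>s. F t s y) has_field_derivative h' x + (\<Sum>k\<in>I. dx (f k) x (y - v k * t))) (at x)"
      unfolding F_def by (intro DERIV_add h DERIV_sum partials(2))
    then show "dx (F t) x y = h' x + (\<Sum>k\<in>I. dx (f k) x (y - v k * t))"
      unfolding dx_def[of "F t"] by (rule DERIV_imp_deriv)
  qed
  show "dy (F t) = (\<lambda>x y. \<Sum>k\<in>I. dy (f k) x (y - v k * t))"
  proof (intro ext)
    fix x y
    have "((\<lambda>s. f k x (s - v k * t)) has_field_derivative dy (f k) x (y - v k * t)) (at y)"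
      if "k \<in> I" for k
      by (rule DERIV_chain'[OF _ partials(3)[OF that], THEN DERIV_cong]) (auto intro!: derivative_eq_intros)
    then have "((\<lambda>s. F t x s) has_field_derivative 0 + (\<Sum>k\<in>I. dy (f k) x (y - v k * t))) (at y)"
      unfolding F_def by (intro DERIV_add DERIV_const DERIV_sum)
    then show "dy (F t) x y = (\<Sum>k\<in>I. dy (f k) x (y - v k * t))"
      unfolding dy_def[of "F t"] by (simp add: DERIV_imp_deriv)
  qed
qed

lemma laplacian_superposition:
  assumes I: "finite I" and f: "\<And>k. k \<in> I \<Longrightarrow> C_k 2 (\<lambda>t. f k)" and h: "smooth h"
  shows "laplacian (\<lambda>x y. h x + (\<Sum>k\<in>I. f k x (y - v k * t))) =
    (\<lambda>x y. deriv (deriv h) x + (\<Sum>k\<in>I. laplacian (f k) x (y - v k * t)))"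
proof -
  have f2: "C_k (Suc (Suc 0)) (\<lambda>t. f k)" if "k \<in> I" for k
    using f[OF that] by (simp only: numeral_2_eq_2)
  note first = superposition_partials(2,3)[where f = f and v = v, OF I f2 smooth_has_deriv[OF h]]
  note xx = superposition_partials(2)[where f = "\<lambda>k. dx (f k)" and v = v, OF I
      C_k_partials(2)[OF f2] smooth_has_deriv[OF smooth_deriv[OF h]]]
  note yy = superposition_partials(3)[where f = "\<lambda>k. dy (f k)" and v = v and h = "\<lambda>x. 0", OF I
      C_k_partials(3)[OF f2] DERIV_const, unfolded add_0]
  show ?thesis
    by (simp add: laplacian_def first xx yy sum.distrib add.assoc)
qed

lemma torus_fun_superposition:
  assumes "\<And>x. h (x + 2*pi) = h x" "\<And>k. k \<in> I \<Longrightarrow> torus_fun (f k)"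
  shows "torus_fun (\<lambda>x y. h x + (\<Sum>k\<in>I. f k x (y - s k)) :: real)"
proof -
  have "f k (x + 2*pi) y = f k x y" "f k x (y + 2*pi - s k) = f k x (y - s k)"
    if "k \<in> I" for k x y
    using assms(2)[OF that, unfolded torus_fun_iff, rule_format, of x y]
      assms(2)[OF that, unfolded torus_fun_iff, rule_format, of x "y - s k"]
    by (simp_all add: algebra_simps)
  then show ?thesis
    by (simp add: torus_fun_iff assms(1) cong: sum.cong)
qed

text \<open>
  Translations commute with the Laplacian, so a translate of a Laplacian is again one.
\<close>

lemma torus_zero_average_travelling_laplacian:
  assumes "C_k 2 (\<lambda>t. f)" "torus_fun f"
  shows "torus_zero_average (\<lambda>x y. laplacian f x (y - v * t))"
proof -
  have shift: "dx (\<lambda>x y. g x (y - v * t)) = (\<lambda>x y. dx g x (y - v * t))"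
    "dy (\<lambda>x y. g x (y - v * t)) = (\<lambda>x y. dy g x (y - v * t))" for g
    using deriv_translate[of "g _" "- (v * t)"] by (simp_all add: dx_def dy_def)
  have "torus_fun (\<lambda>x y. f x (y - v * t))"
    using torus_fun_superposition[of "\<lambda>x. 0" "{()}" "\<lambda>_. f" "\<lambda>_. v * t"] assms(2) by simp
  from torus_zero_average_laplacian[OF C_k_travelling[OF assms(1)] this]
  show ?thesis by (simp add: laplacian_def shift)
qed

text \<open>
  The \<open>k\<close>-th angle is the displacement of the \<open>k\<close>-th summand in \<open>y\<close>.
\<close>

lemma quasi_periodic_superposition:
  assumes h: "continuous_on UNIV h" "\<And>x. h (x + 2*pi) = h x"
    and f: "\<And>k. k \<in> {1..K} \<Longrightarrow> torus_fun (f k)"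
      "\<And>k. k \<in> {1..K} \<Longrightarrow> continuous_on UNIV (\<lambda>(x, y). f k x y)"
  shows "quasi_periodic K v (\<lambda>t x y. h x + (\<Sum>k=1..K. f k x (y - v k * t)))"
  unfolding quasi_periodic_def
proof (intro exI[of _ "\<lambda>\<theta> x y. h x + (\<Sum>k=1..K. f k x (y - \<theta> k))"] conjI ballI allI)
  fix \<theta> :: "nat \<Rightarrow> real" and j
  assume "j \<in> {1..K}"
  have "f j x (y - (\<theta> j + 2*pi)) = f j x (y - \<theta> j)" for x y
    using f(1)[OF \<open>j \<in> {1..K}\<close>, unfolded torus_fun_iff, rule_format, of x "y - (\<theta> j + 2*pi)"]
    by (simp add: algebra_simps)
  then have "f k x (y - (\<theta>(j := \<theta> j + 2*pi)) k) = f k x (y - \<theta> k)" for k x y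
    by (cases "k = j") simp_all
  then show "(\<lambda>x y. h x + (\<Sum>k=1..K. f k x (y - (\<theta>(j := \<theta> j + 2*pi)) k))) =
      (\<lambda>x y. h x + (\<Sum>k=1..K. f k x (y - \<theta> k)))"
    by (simp only:)
next
  fix \<theta> :: "nat \<Rightarrow> real"
  show "torus_fun (\<lambda>x y. h x + (\<Sum>k=1..K. f k x (y - \<theta> k)))"
    by (intro torus_fun_superposition h(2) f(1))
next
  let ?D = "({1..K} \<rightarrow>\<^sub>E UNIV) \<times> (UNIV :: real set) \<times> (UNIV :: real set)"
  have hx: "continuous_on ?D (\<lambda>p. h (fst (snd p)))"
    by (intro continuous_on_compose2[OF h(1)] continuous_intros) auto
  have fk: "continuous_on ?D (\<lambda>p. f k (fst (snd p)) (snd (snd p) - fst p k))" if "k \<in> {1..K}" for k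
  proof -
    have "continuous_on ?D (\<lambda>p. fst p k)"
      by (rule continuous_on_compose2[OF continuous_on_product_coordinates[of k]
            continuous_on_fst[OF continuous_on_id]]) simp
    then have "continuous_on ?D ((\<lambda>(x, y). f k x y) \<circ> (\<lambda>p. (fst (snd p), snd (snd p) - fst p k)))"
      by (intro continuous_on_compose continuous_on_subset[OF f(2)[OF that]] continuous_intros) auto
    then show ?thesis by (simp add: o_def)
  qed
  show "continuous_on ?D (\<lambda>(\<theta>, x, y). h x + (\<Sum>k=1..K. f k x (y - \<theta> k)))"
    unfolding case_prod_unfold by (intro continuous_on_add continuous_on_sum hx fk)
next
  fix t x y
  show "h x + (\<Sum>k=1..K. f k x (y - v k * t)) =
      h x + (\<Sum>k=1..K. f k x (y - (\<lambda>k\<in>{1..K}. v k * t) k))"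
    by simp
qed

section \<open>Superposition of vortices in disjoint strips\<close>

lemma deriv_eq_0_on_open:
  fixes f :: "real \<Rightarrow> real"
  assumes "open U" "x \<in> U" "\<And>s. s \<in> U \<Longrightarrow> f s = 0"
  shows "deriv f x = 0"
proof (rule DERIV_imp_deriv)
  show "(f has_field_derivative 0) (at x)"
    by (rule has_field_derivative_transform_within_open[OF DERIV_const[of 0] assms(1,2)])
      (simp add: assms(3))
qed

lemma open_strip_section: "open {x. (x, y) \<in> torus_strip a b}"
proof -
  have "{x. (x, y) \<in> torus_strip a b} = (\<Union>n::int. {a + 2*pi * of_int n <..< b + 2*pi * of_int n})"
    by (auto simp: torus_strip_def algebra_simps)
  then show ?thesis by auto
qed

lemma torus_strip_indep_y: "(x, y) \<in> torus_strip a b \<longleftrightarrow> (x, y') \<in> torus_strip a b"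
  by (simp add: torus_strip_def)

lemma eq_0_outside_strip:
  assumes "torus_support f \<subseteq> torus_strip a b" "(x, z) \<notin> torus_strip a b"
  shows "f x y = 0"
proof (rule ccontr)
  assume "f x y \<noteq> 0"
  then have "(x, y) \<in> torus_support f"
    unfolding torus_support_def using closure_subset by fastforce
  then show False using assms torus_strip_indep_y by blast
qed

text \<open>
  The derivative in \<open>x\<close> at a point requires the function to vanish on a whole neighbourhood \<open>U\<close>,
  which is available because points of another strip are interior to it.
\<close>

lemma partials_eq_0_outside_strip:
  assumes supp: "torus_support f \<subseteq> torus_strip a b" and U: "open U" "x \<in> U"
    and outside: "\<And>s z. s \<in> U \<Longrightarrow> (s, z) \<notin> torus_strip a b"
  shows "dx f x y = 0" "dy f x y = 0"
proof -
  show "dx f x y = 0"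
    unfolding dx_def
    by (rule deriv_eq_0_on_open[OF U]) (rule eq_0_outside_strip[OF supp outside])
  have "f x s = 0" for s
    by (rule eq_0_outside_strip[OF supp outside[OF U(2)]])
  then show "dy f x y = 0"
    unfolding dy_def by (intro deriv_eq_0_on_open[of UNIV]) auto
qed

lemma sum_eq_single:
  assumes "finite I" "i \<in> I" "\<And>k. k \<in> I - {i} \<Longrightarrow> g k = 0"
  shows "sum g I = (g i :: real)"
  using assms by (simp add: sum.remove)

text \<open>
  At a point of the \<open>i\<close>-th strip, all summands with \<open>k \<noteq> i\<close> vanish near the point, and \<open>V''\<close> vanishes
  near it too.  What remains of the equation is
  \<open>- v\<^sub>i \<partial>\<^sub>y\<Omega>\<^sub>i + (v\<^sub>i + \<partial>\<^sub>x\<Psi>\<^sub>i) \<partial>\<^sub>y\<Omega>\<^sub>i - \<partial>\<^sub>y\<Psi>\<^sub>i \<partial>\<^sub>x\<Omega>\<^sub>i\<close>, which is the Poisson bracket of \<open>\<Psi>\<^sub>i\<close> and \<open>\<Omega>\<^sub>i\<close>.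
  Outside all strips every derivative in \<open>y\<close> and every derivative in \<open>t\<close> is zero.
\<close>

theorem euler_superposition:
  fixes V :: "real \<Rightarrow> real" and a b v :: "'i \<Rightarrow> real"
  assumes V: "smooth V" "\<And>x. V (x + 2*pi) = V x" "circle_zero_average V"
    and I: "finite I"
    and vortex: "\<And>k. k \<in> I \<Longrightarrow> steady_vortex (a k) (b k) (\<Psi> k) (\<Omega> k)"
    and disjoint: "\<And>j k. j \<in> I \<Longrightarrow> k \<in> I \<Longrightarrow> j \<noteq> k \<Longrightarrow>
      torus_strip (a j) (b j) \<inter> torus_strip (a k) (b k) = {}"
    and flow: "\<And>k x y. k \<in> I \<Longrightarrow> (x, y) \<in> torus_strip (a k) (b k) \<Longrightarrow>
      deriv V x = v k \<and> deriv (deriv V) x = 0"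
  defines "\<omega> \<equiv> \<lambda>t x y. deriv (deriv V) x + (\<Sum>k\<in>I. \<Omega> k x (y - v k * t))"
    and "\<psi> \<equiv> \<lambda>t x y. V x + (\<Sum>k\<in>I. \<Psi> k x (y - v k * t))"
  shows "classical_euler_solution \<omega> \<psi>"
proof -
  have C\<Psi>: "C_k 2 (\<lambda>t. \<Psi> k)" and C\<Omega>: "C_k 1 (\<lambda>t. \<Omega> k)"
    and per: "torus_fun (\<Psi> k)" "torus_fun (\<Omega> k)"
    and lap: "laplacian (\<Psi> k) = \<Omega> k" and bracket: "poisson_bracket (\<Psi> k) (\<Omega> k) x y = 0"
    and supp: "torus_support (\<Psi> k) \<subseteq> torus_strip (a k) (b k)"
      "torus_support (\<Omega> k) \<subseteq> torus_strip (a k) (b k)" if "k \<in> I" for k x y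
    using vortex[OF that] by (simp_all add: steady_vortex_def)
  note V' = smooth_deriv[OF V(1)] and V'' = smooth_deriv[OF smooth_deriv[OF V(1)]]
  have V''_per: "deriv (deriv V) (x + 2*pi) = deriv (deriv V) x" for x
    by (intro deriv_periodic V(2))
  have C\<omega>: "C_k 1 \<omega>"
    unfolding \<omega>_def by (intro C_k_add C_k_sum I C_k_shear V'' C_k_travelling C\<Omega>)
  have C\<psi>: "C_k 2 \<psi>"
    unfolding \<psi>_def by (intro C_k_add C_k_sum I C_k_shear V(1) C_k_travelling C\<Psi>)
  have per\<omega>: "torus_fun (\<omega> t)" for t
    unfolding \<omega>_def by (intro torus_fun_superposition V''_per per(2))
  have per\<psi>: "torus_fun (\<psi> t)" for t
    unfolding \<psi>_def by (intro torus_fun_superposition V(2) per(1))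
  have lap\<psi>: "laplacian (\<psi> t) = \<omega> t" for t
    using lap
    by (simp add: \<psi>_def \<omega>_def laplacian_superposition[where f = \<Psi>, OF I C\<Psi> V(1)] cong: sum.cong)
  have avg\<omega>: "torus_zero_average (\<omega> t)" for t
    using torus_zero_average_laplacian[OF C\<psi> per\<psi>] by (simp add: lap\<psi>)
  have avg\<psi>: "torus_zero_average (\<psi> t)" for t
    unfolding \<psi>_def
  proof (intro torus_zero_average_add torus_zero_average_sum I torus_zero_average_shear V(1,3))
    fix k assume "k \<in> I"
    then obtain \<Phi> where \<Phi>: "C_k 2 (\<lambda>t. \<Phi>)" "torus_fun \<Phi>" "laplacian \<Phi> = \<Psi> k"
      using vortex unfolding steady_vortex_def by blast
    show "torus_zero_average (\<lambda>x y. \<Psi> k x (y - v k * t))"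
      by (rule torus_zero_average_travelling_laplacian[OF \<Phi>(1,2), unfolded \<Phi>(3)])
  qed
  have euler: "dt \<omega> t x y + poisson_bracket (\<psi> t) (\<omega> t) x y = 0" for t x y
  proof -
    have \<omega>_partials: "dt \<omega> t x y = (\<Sum>k\<in>I. - v k * dy (\<Omega> k) x (y - v k * t))"
      "dx (\<omega> t) = (\<lambda>x y. deriv (deriv (deriv V)) x + (\<Sum>k\<in>I. dx (\<Omega> k) x (y - v k * t)))"
      "dy (\<omega> t) = (\<lambda>x y. \<Sum>k\<in>I. dy (\<Omega> k) x (y - v k * t))"
      unfolding \<omega>_def
      by (rule superposition_partials[OF I C\<Omega>[unfolded One_nat_def] smooth_has_deriv[OF V'']]; assumption)+
    have \<psi>_partials:
      "dx (\<psi> t) = (\<lambda>x y. deriv V x + (\<Sum>k\<in>I. dx (\<Psi> k) x (y - v k * t)))"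
      "dy (\<psi> t) = (\<lambda>x y. \<Sum>k\<in>I. dy (\<Psi> k) x (y - v k * t))"
      unfolding \<psi>_def
      by (rule superposition_partials[OF I C\<Psi>[unfolded numeral_2_eq_2] smooth_has_deriv[OF V(1)]]; assumption)+
    show ?thesis
    proof (cases "\<exists>i\<in>I. (x, y) \<in> torus_strip (a i) (b i)")
      case True
      then obtain i where i: "i \<in> I" "(x, y) \<in> torus_strip (a i) (b i)" by blast
      define U where "U = {x. (x, y) \<in> torus_strip (a i) (b i)}"
      have U: "open U" "x \<in> U"
        using i(2) by (simp_all add: U_def open_strip_section)
      have outside: "(s, z) \<notin> torus_strip (a k) (b k)" if "k \<in> I - {i}" "s \<in> U" for k s z
        using disjoint[OF i(1), of k] that torus_strip_indep_y by (fastforce simp: U_def)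
      have others: "dx (\<Psi> k) x z = 0" "dy (\<Psi> k) x z = 0" "dx (\<Omega> k) x z = 0" "dy (\<Omega> k) x z = 0"
        if "k \<in> I - {i}" for k z
        using that partials_eq_0_outside_strip[OF supp(1) U outside]
          partials_eq_0_outside_strip[OF supp(2) U outside] by auto
      have V3: "deriv (deriv (deriv V)) x = 0"
        by (rule deriv_eq_0_on_open[OF U]) (use flow[OF i(1)] in \<open>auto simp: U_def\<close>)
      have single: "(\<Sum>k\<in>I. dx (\<Psi> k) x (y - v k * t)) = dx (\<Psi> i) x (y - v i * t)"
        "(\<Sum>k\<in>I. dy (\<Psi> k) x (y - v k * t)) = dy (\<Psi> i) x (y - v i * t)"
        "(\<Sum>k\<in>I. dx (\<Omega> k) x (y - v k * t)) = dx (\<Omega> i) x (y - v i * t)"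
        "(\<Sum>k\<in>I. dy (\<Omega> k) x (y - v k * t)) = dy (\<Omega> i) x (y - v i * t)"
        "(\<Sum>k\<in>I. - v k * dy (\<Omega> k) x (y - v k * t)) = - v i * dy (\<Omega> i) x (y - v i * t)"
        by (rule sum_eq_single[OF I i(1)], simp add: others)+
      show ?thesis
        using flow[OF i] V3 bracket[OF i(1), of x "y - v i * t"]
        unfolding poisson_bracket_def \<omega>_partials \<psi>_partials single
        by (simp add: algebra_simps)
    next
      case False
      have "dy (\<Psi> k) x z = 0" "dy (\<Omega> k) x z = 0" if "k \<in> I" for k z
      proof -
        have "(x, y) \<notin> torus_strip (a k) (b k)" using False that by blast
        then have "\<Psi> k x s = 0" "\<Omega> k x s = 0" for s
          using supp[OF that] eq_0_outside_strip by blast+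
        then show "dy (\<Psi> k) x z = 0" "dy (\<Omega> k) x z = 0"
          unfolding dy_def by (auto intro!: deriv_eq_0_on_open[of UNIV])
      qed
      then show ?thesis
        unfolding poisson_bracket_def \<omega>_partials \<psi>_partials by simp
    qed
  qed
  show ?thesis
    unfolding classical_euler_solution_def
    using C\<omega> C\<psi> per\<omega> per\<psi> avg\<omega> avg\<psi> euler lap\<psi> by simp
qed

section \<open>Vortices in the flat strips of a shear flow\<close>

text \<open>
  As both intervals lie in one period, a point of both strips has the same representative in both
  of them.  The intervals are closed in the hypothesis and open in the strips, so it does not
  matter that the endpoints \<open>0\<close> and \<open>2*pi\<close> are the same point of the circle.
\<close>

lemma torus_strips_disjoint:
  assumes "{a..b} \<subseteq> {0..2*pi}" "{a'..b'} \<subseteq> {0..2*pi}" "{a..b} \<inter> {a'..b'} = {}" "a < b" "a' < b'"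
  shows "torus_strip a b \<inter> torus_strip a' b' = {}"
proof -
  have False if m: "x - 2*pi * of_int m \<in> {a<..<b}" and n: "x - 2*pi * of_int n \<in> {a'<..<b'}"
    for x and m n :: int
  proof -
    have "0 \<le> a" "b \<le> 2*pi" "0 \<le> a'" "b' \<le> 2*pi" using assms(1,2,4,5) by auto
    then have "\<bar>2*pi * of_int (m - n)\<bar> < 2*pi" 
      using m n by (auto simp: algebra_simps)
    then have "\<bar>m - n\<bar> < 1" by (simp add: abs_mult)
    then have "x - 2*pi * of_int m \<in> {a..b} \<inter> {a'..b'}" using m n by simp
    then show False using assms(3) by blast
  qed
  then show ?thesis by (fastforce simp: torus_strip_def)
qed

lemma flow_in_strip:
  assumes "smooth V" and per: "\<And>x. V (x + 2*pi) = V x"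
    and flat: "\<And>x. x \<in> {a..b} \<Longrightarrow> deriv (deriv V) x = 0"
    and c: "c \<in> {a<..<b}" and x: "(x, y) \<in> torus_strip a b"
  shows "deriv V x = deriv V c" "deriv (deriv V) x = 0"
proof -
  obtain n :: int where n: "x - 2*pi * of_int n \<in> {a<..<b}"
    using x by (auto simp: torus_strip_def)
  have V'_per: "deriv V (x + 2*pi) = deriv V x" for x
    by (intro deriv_periodic per)
  have V''_per: "deriv (deriv V) (x + 2*pi) = deriv (deriv V) x" for x
    by (intro deriv_periodic V'_per)
  interpret V': periodic_fun_simple "deriv V" "2*pi" by standard (rule V'_per)
  interpret V'': periodic_fun_simple "deriv (deriv V)" "2*pi" by standard (rule V''_per)
  have shift: "deriv V x = deriv V (x - 2*pi * of_int n)"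
    "deriv (deriv V) x = deriv (deriv V) (x - 2*pi * of_int n)"
    using V'.minus_of_int[of x n] V''.minus_of_int[of x n] by (simp_all add: mult.commute)
  then show "deriv (deriv V) x = 0" using flat n by simp
  have "deriv V (x - 2*pi * of_int n) = deriv V c"
  proof (rule DERIV_isconst3[where f = "deriv V"])
    show "a < b" using c by simp
    show "x - 2*pi * of_int n \<in> {a<..<b}" by (rule n)
    show "c \<in> {a<..<b}" by (rule c)
    fix s assume "s \<in> {a<..<b}"
    then show "(deriv V has_field_derivative 0) (at s)"
      using smooth_has_deriv[OF smooth_deriv[OF assms(1)], of s] flat[of s] by simp
  qed
  then show "deriv V x = deriv V c" using shift by simp
qed

theorem theorem2p2:
  fixes K :: nat and V :: "real \<Rightarrow> real" and a b :: "nat \<Rightarrow> real"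
  assumes V_smooth: "smooth V"
    and V_periodic: "periodic_fun_simple V (2*pi)"
    and V_average: "circle_zero_average V"
    and intervals: "\<forall>k\<in>{1..K}. a k \<in> {0..2*pi} \<and> b k \<in> {0..2*pi} \<and> a k < b k"
    and disjoint: "\<forall>j\<in>{1..K}. \<forall>k\<in>{1..K}. j \<noteq> k \<longrightarrow> {a j..b j} \<inter> {a k..b k} = {}"
    and V_flat: "\<forall>k\<in>{1..K}. \<forall>x\<in>{a k..b k}. deriv (deriv V) x = 0"
  shows "\<exists>(xc :: nat \<Rightarrow> real) (yc :: nat \<Rightarrow> real)
            (\<Omega> :: nat \<Rightarrow> real \<Rightarrow> real \<Rightarrow> real) (\<Psi> :: nat \<Rightarrow> real \<Rightarrow> real \<Rightarrow> real).
      (\<forall>k\<in>{1..K}.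
         xc k \<in> {a k<..<b k} \<and>
         torus_fun (\<Omega> k) \<and> torus_fun (\<Psi> k) \<and>
         \<Omega> k \<noteq> (\<lambda>x y. 0) \<and> \<Psi> k \<noteq> (\<lambda>x y. 0) \<and>
         torus_zero_average (\<Omega> k) \<and> torus_zero_average (\<Psi> k) \<and>
         torus_support (\<Omega> k) \<subseteq> torus_strip (a k) (b k) \<and>
         torus_support (\<Psi> k) \<subseteq> torus_strip (a k) (b k) \<and>
         radially_symmetric_around (\<Omega> k) (xc k, yc k) \<and>
         radially_symmetric_around (\<Psi> k) (xc k, yc k)) \<and>
      (let v = (\<lambda>k. deriv V (xc k));
           \<omega> = (\<lambda>t x y. deriv (deriv V) x + (\<Sum>k=1..K. \<Omega> k x (y - v k * t)));
           \<psi> = (\<lambda>t x y. V x + (\<Sum>k=1..K. \<Psi> k x (y - v k * t)))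
       in classical_euler_solution \<omega> \<psi> \<and> quasi_periodic K v \<omega> \<and> quasi_periodic K v \<psi>)"
proof -
  define xc where "xc = (\<lambda>k. (a k + b k) / 2)"
  have ab: "0 \<le> a k" "b k \<le> 2*pi" "a k < b k" if "k \<in> {1..K}" for k
    using bspec[OF intervals that] by simp_all
  have per: "V (x + 2*pi) = V x" for x
    using V_periodic by (rule periodic_fun_simple.plus_period)
  have V''_per: "deriv (deriv V) (x + 2*pi) = deriv (deriv V) x" for x
    by (intro deriv_periodic per)
  have "\<forall>k. \<exists>\<Psi> \<Omega>. k \<in> {1..K} \<longrightarrow> steady_vortex (a k) (b k) \<Psi> \<Omega> \<and>
      radially_symmetric_around \<Psi> (xc k, 0) \<and> radially_symmetric_around \<Omega> (xc k, 0) \<and>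
      \<Psi> \<noteq> (\<lambda>x y. 0) \<and> \<Omega> \<noteq> (\<lambda>x y. 0)" (is "\<forall>k. \<exists>\<Psi> \<Omega>. ?P k \<Psi> \<Omega>")
  proof
    fix k
    show "\<exists>\<Psi> \<Omega>. ?P k \<Psi> \<Omega>"
    proof (cases "k \<in> {1..K}")
      case True
      then have "a k < b k" "b k - a k \<le> 2*pi"
        using ab[OF True] by simp_all
      then show ?thesis
        unfolding xc_def by (rule exists_radial_steady_vortex) blast
    qed blast
  qed
  then obtain \<Psi> \<Omega> where all: "\<forall>k. ?P k (\<Psi> k) (\<Omega> k)"
    unfolding choice_iff by blast
  then have vortex: "\<And>k. k \<in> {1..K} \<Longrightarrow> steady_vortex (a k) (b k) (\<Psi> k) (\<Omega> k)"
    and radial: "\<And>k. k \<in> {1..K} \<Longrightarrow> radially_symmetric_around (\<Psi> k) (xc k, 0)"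
      "\<And>k. k \<in> {1..K} \<Longrightarrow> radially_symmetric_around (\<Omega> k) (xc k, 0)"
    and nonzero: "\<And>k. k \<in> {1..K} \<Longrightarrow> \<Psi> k \<noteq> (\<lambda>x y. 0)" "\<And>k. k \<in> {1..K} \<Longrightarrow> \<Omega> k \<noteq> (\<lambda>x y. 0)"
    by blast+
  have avg: "torus_zero_average (\<Omega> k)" "torus_zero_average (\<Psi> k)" if k: "k \<in> {1..K}" for k
  proof -
    obtain \<Phi> where \<Phi>: "C_k 2 (\<lambda>t. \<Phi>)" "torus_fun \<Phi>" "laplacian \<Phi> = \<Psi> k"
      using vortex[OF k] unfolding steady_vortex_def by blast
    have \<Psi>: "C_k 2 (\<lambda>t. \<Psi> k)" "torus_fun (\<Psi> k)" "laplacian (\<Psi> k) = \<Omega> k"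
      using vortex[OF k] unfolding steady_vortex_def by blast+
    show "torus_zero_average (\<Omega> k)"
      using torus_zero_average_laplacian[OF \<Psi>(1,2)] \<Psi>(3) by simp
    show "torus_zero_average (\<Psi> k)"
      using torus_zero_average_laplacian[OF \<Phi>(1,2)] \<Phi>(3) by simp
  qed
  have xc: "xc k \<in> {a k<..<b k}" if "k \<in> {1..K}" for k
    using ab[OF that] by (simp add: xc_def)
  have smooth_data: "torus_fun (\<Omega> k)" "continuous_on UNIV (\<lambda>(x, y). \<Omega> k x y)"
    "torus_fun (\<Psi> k)" "continuous_on UNIV (\<lambda>(x, y). \<Psi> k x y)" if k: "k \<in> {1..K}" for k
    using vortex[OF k] continuous_on_C_k_slice[of 1 "\<lambda>t. \<Omega> k"] continuous_on_C_k_slice[of 2 "\<lambda>t. \<Psi> k"]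
    unfolding steady_vortex_def by blast+
  define v where "v = (\<lambda>k. deriv V (xc k))"
  have "classical_euler_solution
      (\<lambda>t x y. deriv (deriv V) x + (\<Sum>k=1..K. \<Omega> k x (y - v k * t)))
      (\<lambda>t x y. V x + (\<Sum>k=1..K. \<Psi> k x (y - v k * t)))"
  proof (rule euler_superposition[OF V_smooth per V_average _ vortex])
    show "torus_strip (a j) (b j) \<inter> torus_strip (a k) (b k) = {}"
      if "j \<in> {1..K}" "k \<in> {1..K}" "j \<noteq> k" for j k
    proof (rule torus_strips_disjoint)
      show "{a j..b j} \<inter> {a k..b k} = {}"
        using disjoint that by blast
    qed (use ab[OF that(1)] ab[OF that(2)] in auto)
    show "deriv V x = v k \<and> deriv (deriv V) x = 0"
      if "k \<in> {1..K}" "(x, y) \<in> torus_strip (a k) (b k)" for k x y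
      unfolding v_def
      using flow_in_strip[OF V_smooth per _ xc[OF that(1)] that(2)] V_flat that(1) by blast
  qed simp_all
  moreover have "quasi_periodic K v (\<lambda>t x y. deriv (deriv V) x + (\<Sum>k=1..K. \<Omega> k x (y - v k * t)))"
    by (intro quasi_periodic_superposition smooth_continuous smooth_deriv V_smooth V''_per smooth_data)
  moreover have "quasi_periodic K v (\<lambda>t x y. V x + (\<Sum>k=1..K. \<Psi> k x (y - v k * t)))"
    by (intro quasi_periodic_superposition smooth_continuous V_smooth per smooth_data)
  moreover have "\<forall>k\<in>{1..K}.
         xc k \<in> {a k<..<b k} \<and>
         torus_fun (\<Omega> k) \<and> torus_fun (\<Psi> k) \<and>
         \<Omega> k \<noteq> (\<lambda>x y. 0) \<and> \<Psi> k \<noteq> (\<lambda>x y. 0) \<and>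
         torus_zero_average (\<Omega> k) \<and> torus_zero_average (\<Psi> k) \<and>
         torus_support (\<Omega> k) \<subseteq> torus_strip (a k) (b k) \<and>
         torus_support (\<Psi> k) \<subseteq> torus_strip (a k) (b k) \<and>
         radially_symmetric_around (\<Omega> k) (xc k, 0) \<and>
         radially_symmetric_around (\<Psi> k) (xc k, 0)"
    using xc smooth_data nonzero avg vortex[unfolded steady_vortex_def] radial by blast
  ultimately show ?thesis
    unfolding Let_def v_def
    by (intro exI[of _ xc] exI[of _ "\<lambda>k. 0"] exI[of _ \<Omega>] exI[of _ \<Psi>] conjI)
qed

end
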